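(* Let $k$ be a field, let $\mathbf{a}=(a_1,\dots,a_n),\mathbf{b}=(b_1,\dots,b_n)\in\mathbb{N}^n$ with $(\mathbf{a},\mathbf{b})$ non-degenerate, let $\mathcal{B}=\mathcal{B}((\mathbf{x}^{\mathbf{a}}),(\mathbf{x}^{\mathbf{b}}))$ be the intersection algebra of the ideals $(x_1^{a_1}\cdots x_n^{a_n})$ and $(x_1^{b_1}\cdots x_n^{b_n})$ of $k[x_1,\dots,x_n]$, and let $\Phi=\Phi_{\mathbf{a},\mathbf{b}}$. Then the number of minimal positive elements of $E_\Phi$, and thus the (minimal) number of generators of the canonical ideal $\Omega(\mathcal{B})$, is $$\sum_{i=0}^n|\mathcal{H}_i|-(n+2),$$ where $\mathcal{H}_i$ is the Hilbert basis of $Q_i=C_i\cap\mathbb{Z}^2$ and $C_0,\dots,C_n$ are the cones of the fan $\Sigma_{\mathbf{a},\mathbf{b}}$.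
   Context: $\mathbb{N}$ denotes the nonnegative integers. The intersection algebra of ideals $I,J$ of a ring $R$ is $\mathcal{B}(I,J)=\sum_{r,s\in\mathbb{N}}(I^r\cap J^s)u^rv^s\subseteq R[u,v]$. Put $a_0=1$, $b_0=0$, $a_{n+1}=0$, $b_{n+1}=1$. $(\mathbf{a},\mathbf{b})$ is non-degenerate if $a_i/b_i>a_{i+1}/b_{i+1}$ for all $i=0,\dots,n$, with the convention $a_i/b_i=\infty$ if $b_i=0$. For $i=0,\dots,n$, $C_i=\{\lambda_1(b_i,a_i)+\lambda_2(b_{i+1},a_{i+1}) : \lambda_1,\lambda_2\in\mathbb{R}_{\ge0}\}$; the fan $\Sigma_{\mathbf{a},\mathbf{b}}$ consists of these cones and their faces. The Hilbert basis of $Q_i=C_i\cap\mathbb{Z}^2$ is its unique finite minimal generating set as a semigroup. $\Phi_{\mathbf{a},\mathbf{b}}$ is the $2n\times(3n+2)$ integer matrix such that $$E_\Phi=\{\boldsymbol\beta\in\mathbb{N}^{3n+2} : \Phi\boldsymbol\beta=0\}=\{(r,s,h_1,k_1,m_1,\dots,h_n,k_n,m_n)\in\mathbb{N}^{3n+2} : a_ir+h_i=m_i=b_is+k_i,\ i=1,\dots,n\}.$$ $\boldsymbol\beta\in E_\Phi$ is positive if each coordinate is positive. A positive $\boldsymbol\beta\in E_\Phi$ is minimal if there is no positive $\boldsymbol\gamma\in E_\Phi$ with $\boldsymbol\gamma\neq\boldsymbol\beta$ and $\boldsymbol\beta-\boldsymbol\gamma\ge0$ coordinatewise. The semigroup algebra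 $R_\Phi=k[E_\Phi]$ is isomorphic to $\mathcal{B}$ via $(r,s,h_1,k_1,m_1,\dots,h_n,k_n,m_n)\mapsto x_1^{m_1}\cdots x_n^{m_n}u^rv^s$. The canonical ideal $\Omega(\mathcal{B})$ is the ideal of $\mathcal{B}$ spanned over $k$ by the monomials corresponding to the positive elements of $E_\Phi$ (by a theorem of Stanley it is isomorphic to the canonical module of $\mathcal{B}$). *)

theory Defs
  imports
    Complex_Main
    "HOL-Library.Poly_Mapping"
    "HOL-Library.Product_Plus"
    "HOL-Library.Extended_Real"
    "HOL-Library.Extended_Nat"
    "HOL-Algebra.Ideal"
    "HOL-Algebra.Ideal_Product"
    "Jordan_Normal_Form.Matrix"
begin

text \<open>
  The exponent vectors \<open>(a\<^sub>1, \<dots>, a\<^sub>n)\<close> and \<open>(b\<^sub>1, \<dots>, b\<^sub>n)\<close> are functions \<open>nat \<Rightarrow> nat\<close> of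
  which only the values at \<open>1, \<dots>, n\<close> matter; the boundary values at \<open>0\<close> and \<open>n + 1\<close> are
  supplied by \<open>ext_a\<close> and \<open>ext_b\<close>.
\<close>

definition ext_a :: "nat \<Rightarrow> (nat \<Rightarrow> nat) \<Rightarrow> nat \<Rightarrow> nat" where
  "ext_a n a i = (if i = 0 then 1 else if i = n + 1 then 0 else a i)"

definition ext_b :: "nat \<Rightarrow> (nat \<Rightarrow> nat) \<Rightarrow> nat \<Rightarrow> nat" where
  "ext_b n b i = (if i = 0 then 0 else if i = n + 1 then 1 else b i)"

definition slope :: "nat \<Rightarrow> nat \<Rightarrow> ereal" where
  "slope p q = (if q = 0 then \<infinity> else ereal (real p / real q))"

definition nondegenerate :: "nat \<Rightarrow> (nat \<Rightarrow> nat) \<Rightarrow> (nat \<Rightarrow> nat) \<Rightarrow> bool" where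
  "nondegenerate n a b \<longleftrightarrow>
    (\<forall>i\<le>n. slope (ext_a n a i) (ext_b n b i) > slope (ext_a n a (i + 1)) (ext_b n b (i + 1)))"


subsection \<open>The fan and the Hilbert bases\<close>

definition fan_cone :: "nat \<Rightarrow> (nat \<Rightarrow> nat) \<Rightarrow> (nat \<Rightarrow> nat) \<Rightarrow> nat \<Rightarrow> (real \<times> real) set" where
  "fan_cone n a b i =
    {(l1 * real (ext_b n b i) + l2 * real (ext_b n b (i + 1)),
      l1 * real (ext_a n a i) + l2 * real (ext_a n a (i + 1))) | l1 l2. 0 \<le> l1 \<and> 0 \<le> l2}"

definition cone_semigroup :: "nat \<Rightarrow> (nat \<Rightarrow> nat) \<Rightarrow> (nat \<Rightarrow> nat) \<Rightarrow> nat \<Rightarrow> (int \<times> int) set" where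
  "cone_semigroup n a b i = {(r, s). (real_of_int r, real_of_int s) \<in> fan_cone n a b i}"

text \<open>
  Semigroups are taken with neutral element, so \<open>0\<close> is generated by the empty set and does
  not belong to a Hilbert basis.
\<close>

inductive_set semigroup_gen :: "'a::comm_monoid_add set \<Rightarrow> 'a set" for H :: "'a set" where
  zero: "0 \<in> semigroup_gen H"
| add: "h \<in> H \<Longrightarrow> x \<in> semigroup_gen H \<Longrightarrow> h + x \<in> semigroup_gen H"

definition hilbert_basis :: "'a::comm_monoid_add set \<Rightarrow> 'a set" where
  "hilbert_basis Q =
    (THE H. finite H \<and> semigroup_gen H = Q \<and> (\<forall>H'. H' \<subset> H \<longrightarrow> semigroup_gen H' \<noteq> Q))"


subsection \<open>The semigroup of solutions\<close>

text \<open>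
  Coordinates of \<open>\<nat>\<close>-vectors of dimension \<open>3 * n + 2\<close> are counted from \<open>0\<close>: \<open>r\<close> and \<open>s\<close> sit at
  \<open>0\<close> and \<open>1\<close>, and \<open>h\<^sub>i, k\<^sub>i, m\<^sub>i\<close> at \<open>3 * i - 1\<close>, \<open>3 * i\<close>, \<open>3 * i + 1\<close> for \<open>1 \<le> i \<le> n\<close>.
  For such \<open>i\<close>, row \<open>2 * (i - 1)\<close> of the matrix encodes \<open>a\<^sub>i r + h\<^sub>i - m\<^sub>i = 0\<close> and row
  \<open>2 * (i - 1) + 1\<close> encodes \<open>b\<^sub>i s + k\<^sub>i - m\<^sub>i = 0\<close>; see \<open>E_Phi_iff\<close>.
\<close>

definition Phi :: "nat \<Rightarrow> (nat \<Rightarrow> nat) \<Rightarrow> (nat \<Rightarrow> nat) \<Rightarrow> int mat" where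
  "Phi n a b = mat (2 * n) (3 * n + 2) (\<lambda>(row, col).
    let i = row div 2 + 1 in
      if even row
      then (if col = 0 then int (a i) else if col = 3 * i - 1 then 1
            else if col = 3 * i + 1 then -1 else 0)
      else (if col = 1 then int (b i) else if col = 3 * i then 1
            else if col = 3 * i + 1 then -1 else 0))"

definition E_Phi :: "nat \<Rightarrow> (nat \<Rightarrow> nat) \<Rightarrow> (nat \<Rightarrow> nat) \<Rightarrow> nat vec set" where
  "E_Phi n a b =
    {\<beta> \<in> carrier_vec (3 * n + 2). Phi n a b *\<^sub>v map_vec int \<beta> = 0\<^sub>v (2 * n)}"

lemma E_Phi_iff:
  "\<beta> \<in> E_Phi n a b \<longleftrightarrow> \<beta> \<in> carrier_vec (3 * n + 2) \<and>
    (\<forall>i\<in>{1..n}. a i * \<beta> $ 0 + \<beta> $ (3 * i - 1) = \<beta> $ (3 * i + 1) \<and>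
                b i * \<beta> $ 1 + \<beta> $ (3 * i) = \<beta> $ (3 * i + 1))"
proof (cases "\<beta> \<in> carrier_vec (3 * n + 2)")
  case True
  then have dim: "dim_vec \<beta> = 3 * n + 2" by auto
  have entry: "(Phi n a b *\<^sub>v map_vec int \<beta>) $ row =
      (\<Sum>col\<in>{0..<3 * n + 2}. Phi n a b $$ (row, col) * int (\<beta> $ col))"
    if "row < 2 * n" for row
    using that dim by (auto simp: Phi_def scalar_prod_def intro!: sum.cong)
  have even_row: "(Phi n a b *\<^sub>v map_vec int \<beta>) $ (2 * (i - 1)) =
      int (a i) * int (\<beta> $ 0) + int (\<beta> $ (3 * i - 1)) - int (\<beta> $ (3 * i + 1))"
    if i: "i \<in> {1..n}" for i
  proof -
    have ne: "3 * i - Suc 0 \<noteq> Suc (3 * i)" "3 * i - Suc 0 \<noteq> 0" "Suc (3 * i) \<noteq> 3 * i - Suc 0"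
      using i by auto
    have "(Phi n a b *\<^sub>v map_vec int \<beta>) $ (2 * (i - 1)) =
        (\<Sum>col\<in>{0..<3 * n + 2}. (if col = 0 then int (a i) * int (\<beta> $ col) else 0)
          + (if col = 3 * i - 1 then int (\<beta> $ col) else 0)
          + (if col = 3 * i + 1 then - int (\<beta> $ col) else 0))"
      using i ne by (subst entry) (auto simp: Phi_def Let_def intro!: sum.cong)
    then show ?thesis using i by (simp add: sum.distrib) (auto simp: sum.delta)
  qed
  have odd_row: "(Phi n a b *\<^sub>v map_vec int \<beta>) $ (2 * (i - 1) + 1) =
      int (b i) * int (\<beta> $ 1) + int (\<beta> $ (3 * i)) - int (\<beta> $ (3 * i + 1))"
    if i: "i \<in> {1..n}" for i
  proof -
    have lt: "2 * (i - 1) + 1 < 2 * n" using i by auto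
    obtain j where j: "i = Suc j" using i by (cases i) auto
    have "(Phi n a b *\<^sub>v map_vec int \<beta>) $ (2 * (i - 1) + 1) =
        (\<Sum>col\<in>{0..<3 * n + 2}. (if col = 1 then int (b i) * int (\<beta> $ col) else 0)
          + (if col = 3 * i then int (\<beta> $ col) else 0)
          + (if col = 3 * i + 1 then - int (\<beta> $ col) else 0))"
      unfolding entry[OF lt]
    proof (rule sum.cong[OF refl])
      fix col assume "col \<in> {0..<3 * n + 2}"
      then have "Phi n a b $$ (2 * (i - 1) + 1, col) =
          (if col = 1 then int (b i) else if col = 3 * i then 1
           else if col = 3 * i + 1 then -1 else 0)"
        using lt by (simp add: Phi_def Let_def j)
      then show "Phi n a b $$ (2 * (i - 1) + 1, col) * int (\<beta> $ col) =
          (if col = 1 then int (b i) * int (\<beta> $ col) else 0)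
          + (if col = 3 * i then int (\<beta> $ col) else 0)
          + (if col = 3 * i + 1 then - int (\<beta> $ col) else 0)"
        using i by auto
    qed
    then show ?thesis using i by (simp add: sum.distrib) (auto simp: sum.delta)
  qed
  have "Phi n a b *\<^sub>v map_vec int \<beta> = 0\<^sub>v (2 * n) \<longleftrightarrow>
      (\<forall>row<2 * n. (Phi n a b *\<^sub>v map_vec int \<beta>) $ row = 0)"
    by (auto simp: vec_eq_iff Phi_def)
  also have "\<dots> \<longleftrightarrow> (\<forall>i\<in>{1..n}. (Phi n a b *\<^sub>v map_vec int \<beta>) $ (2 * (i - 1)) = 0 \<and>
      (Phi n a b *\<^sub>v map_vec int \<beta>) $ (2 * (i - 1) + 1) = 0)" (is "?L \<longleftrightarrow> ?R")
  proof
    assume ?L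
    then show ?R by auto
  next
    assume R: ?R
    show ?L
    proof (intro allI impI)
      fix row assume row: "row < 2 * n"
      define i where "i = row div 2 + 1"
      have i: "i \<in> {1..n}" using row by (auto simp: i_def)
      have "row = 2 * (i - 1) \<or> row = 2 * (i - 1) + 1" by (auto simp: i_def)
      then show "(Phi n a b *\<^sub>v map_vec int \<beta>) $ row = 0" using R i by metis
    qed
  qed
  also have "\<dots> \<longleftrightarrow> (\<forall>i\<in>{1..n}. a i * \<beta> $ 0 + \<beta> $ (3 * i - 1) = \<beta> $ (3 * i + 1) \<and>
      b i * \<beta> $ 1 + \<beta> $ (3 * i) = \<beta> $ (3 * i + 1))"
  proof (rule ball_cong[OF refl])
    fix i assume i: "i \<in> {1..n}"
    have "int (a i) * int (\<beta> $ 0) + int (\<beta> $ (3 * i - 1)) - int (\<beta> $ (3 * i + 1)) = 0 \<longleftrightarrow>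
        a i * \<beta> $ 0 + \<beta> $ (3 * i - 1) = \<beta> $ (3 * i + 1)"
      unfolding right_minus_eq of_nat_mult[symmetric] of_nat_add[symmetric] of_nat_eq_iff ..
    moreover have "int (b i) * int (\<beta> $ 1) + int (\<beta> $ (3 * i)) - int (\<beta> $ (3 * i + 1)) = 0 \<longleftrightarrow>
        b i * \<beta> $ 1 + \<beta> $ (3 * i) = \<beta> $ (3 * i + 1)"
      unfolding right_minus_eq of_nat_mult[symmetric] of_nat_add[symmetric] of_nat_eq_iff ..
    ultimately show "((Phi n a b *\<^sub>v map_vec int \<beta>) $ (2 * (i - 1)) = 0 \<and>
      (Phi n a b *\<^sub>v map_vec int \<beta>) $ (2 * (i - 1) + 1) = 0) \<longleftrightarrow>
      (a i * \<beta> $ 0 + \<beta> $ (3 * i - 1) = \<beta> $ (3 * i + 1) \<and>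
      b i * \<beta> $ 1 + \<beta> $ (3 * i) = \<beta> $ (3 * i + 1))"
      unfolding even_row[OF i] odd_row[OF i] by simp
  qed
  finally show ?thesis using True by (simp add: E_Phi_def)
qed (simp add: E_Phi_def)

definition positive_vec :: "nat vec \<Rightarrow> bool" where
  "positive_vec \<beta> \<longleftrightarrow> (\<forall>j<dim_vec \<beta>. 0 < \<beta> $ j)"

definition positive_E :: "nat \<Rightarrow> (nat \<Rightarrow> nat) \<Rightarrow> (nat \<Rightarrow> nat) \<Rightarrow> nat vec set" where
  "positive_E n a b = {\<beta> \<in> E_Phi n a b. positive_vec \<beta>}"

definition minimal_positive_E :: "nat \<Rightarrow> (nat \<Rightarrow> nat) \<Rightarrow> (nat \<Rightarrow> nat) \<Rightarrow> nat vec set" where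
  "minimal_positive_E n a b =
    {\<beta> \<in> positive_E n a b.
      \<not> (\<exists>\<gamma>\<in>positive_E n a b. \<gamma> \<noteq> \<beta> \<and> (\<forall>j<3 * n + 2. \<gamma> $ j \<le> \<beta> $ j))}"


subsection \<open>The intersection algebra\<close>

definition ring_on :: "'r::comm_ring_1 set \<Rightarrow> 'r ring" where
  "ring_on S = \<lparr>carrier = S, monoid.mult = (*), one = 1, zero = 0, add = (+)\<rparr>"

primrec ideal_pow :: "('r, 'm) ring_scheme \<Rightarrow> 'r set \<Rightarrow> nat \<Rightarrow> 'r set" where
  "ideal_pow R I 0 = carrier R"
| "ideal_pow R I (Suc r) = ideal_prod R I (ideal_pow R I r)"

text \<open>
  For a subring \<open>S\<close> of the ring \<open>'r\<close>, the elements of \<open>S[u, v]\<close> are the finitely supported maps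
  from exponent pairs \<open>(r, s)\<close> to coefficients in \<open>S\<close>; \<open>Poly_Mapping.single (r, s) c\<close> is
  \<open>c u\<^sup>r v\<^sup>s\<close>.
\<close>

definition intersection_algebra ::
    "'r::comm_ring_1 set \<Rightarrow> 'r set \<Rightarrow> 'r set \<Rightarrow> (nat \<times> nat \<Rightarrow>\<^sub>0 'r) ring" where
  "intersection_algebra S I J = ring_on
    {f. \<forall>r s. Poly_Mapping.lookup f (r, s) \<in> ideal_pow (ring_on S) I r \<inter> ideal_pow (ring_on S) J s}"

definition mpolys :: "nat \<Rightarrow> ((nat \<Rightarrow>\<^sub>0 nat) \<Rightarrow>\<^sub>0 'k::field) set" where
  "mpolys n = {p. \<forall>m\<in>Poly_Mapping.keys p. Poly_Mapping.keys m \<subseteq> {1..n}}"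

definition xvar :: "nat \<Rightarrow> ((nat \<Rightarrow>\<^sub>0 nat) \<Rightarrow>\<^sub>0 'k::field)" where
  "xvar i = Poly_Mapping.single (Poly_Mapping.single i 1) 1"

definition xmonom :: "nat \<Rightarrow> (nat \<Rightarrow> nat) \<Rightarrow> ((nat \<Rightarrow>\<^sub>0 nat) \<Rightarrow>\<^sub>0 'k::field)" where
  "xmonom n e = (\<Prod>i\<in>{1..n}. xvar i ^ e i)"

definition monomial_intersection_algebra ::
    "nat \<Rightarrow> (nat \<Rightarrow> nat) \<Rightarrow> (nat \<Rightarrow> nat) \<Rightarrow> (nat \<times> nat \<Rightarrow>\<^sub>0 ((nat \<Rightarrow>\<^sub>0 nat) \<Rightarrow>\<^sub>0 'k::field)) ring" where
  "monomial_intersection_algebra n a b =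
    intersection_algebra (mpolys n)
      (PIdl\<^bsub>ring_on (mpolys n)\<^esub> (xmonom n a)) (PIdl\<^bsub>ring_on (mpolys n)\<^esub> (xmonom n b))"


subsection \<open>The canonical ideal\<close>

definition B_monom :: "nat \<Rightarrow> nat vec \<Rightarrow> (nat \<times> nat \<Rightarrow>\<^sub>0 ((nat \<Rightarrow>\<^sub>0 nat) \<Rightarrow>\<^sub>0 'k::field))" where
  "B_monom n \<beta> = Poly_Mapping.single (\<beta> $ 0, \<beta> $ 1) (xmonom n (\<lambda>i. \<beta> $ (3 * i + 1)))"

definition B_const :: "'k::field \<Rightarrow> (nat \<times> nat \<Rightarrow>\<^sub>0 ((nat \<Rightarrow>\<^sub>0 nat) \<Rightarrow>\<^sub>0 'k))" where
  "B_const c = Poly_Mapping.single 0 (Poly_Mapping.single 0 c)"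

definition canonical_ideal ::
    "nat \<Rightarrow> (nat \<Rightarrow> nat) \<Rightarrow> (nat \<Rightarrow> nat) \<Rightarrow> (nat \<times> nat \<Rightarrow>\<^sub>0 ((nat \<Rightarrow>\<^sub>0 nat) \<Rightarrow>\<^sub>0 'k::field)) set" where
  "canonical_ideal n a b =
    {\<Sum>\<beta>\<in>F. B_const (c \<beta>) * B_monom n \<beta> | F c. finite F \<and> F \<subseteq> positive_E n a b}"

text \<open>The value is \<open>\<infinity>\<close> if there is no finite generating set, in particular if \<open>I\<close> is not an ideal.\<close>

definition min_num_generators :: "('r, 'm) ring_scheme \<Rightarrow> 'r set \<Rightarrow> enat" where
  "min_num_generators R I =
    (INF G\<in>{G. finite G \<and> G \<subseteq> carrier R \<and> Idl\<^bsub>R\<^esub> G = I}. enat (card G))"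

end

theory Submission
  imports Defs
begin

text \<open>
  A positive solution \<open>(r, s, h, k, m)\<close> that is minimal has \<open>m\<^sub>i = \<phi>\<^sub>i(r, s) + 1\<close> with
  \<open>\<phi>\<^sub>i(r, s) = max (a\<^sub>i r) (b\<^sub>i s)\<close>, because a larger \<open>m\<^sub>i\<close> could be lowered together with \<open>h\<^sub>i\<close> and
  \<open>k\<^sub>i\<close>. It is therefore determined by the lattice point \<open>p = (r, s)\<close>. The point is minimal exactly
  when it is not a sum \<open>x + y\<close> of a positive point \<open>x\<close> and a nonzero nonnegative point \<open>y\<close> with
  \<open>\<phi>\<^sub>i(x) + \<phi>\<^sub>i(y) \<le> \<phi>\<^sub>i(p)\<close> for all \<open>i\<close> (\<open>tight_minimal_iff\<close>). The function \<open>\<phi>\<^sub>i\<close> is subadditive, with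
  equality when \<open>x\<close> and \<open>y\<close> lie on the same side of the ray through \<open>(b\<^sub>i, a\<^sub>i)\<close> and not otherwise. So
  the forbidden splittings are those in which \<open>x\<close> and \<open>y\<close> lie in a common cone of the fan.

  The Hilbert basis of the lattice points of a cone consists of its irreducible elements
  (\<open>hilbert_basis_eq_irreducibles\<close>). Hence the minimal points are the elements of the Hilbert bases,
  except for \<open>(0, 1)\<close> and \<open>(1, 0)\<close>, which are not positive (\<open>minimal_points_eq\<close>). Two adjacent cones
  share one element of their bases, the primitive vector on the common ray, and other pairs of
  cones share none (\<open>card_union_irreducibles\<close>). The \<open>n\<close> common rays and the two excluded unit
  vectors account for the correction \<open>n + 2\<close>.

  For the generators, the intersection algebra and the canonical ideal are both spanned by
  monomials. The monomials of the minimal positive solutions generate the ideal. No smaller set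
  does: multiplication by an element of the algebra acts on the coefficients at minimal exponents
  as a scalar (\<open>truncate_mult\<close>), so any set of generators projects onto a spanning set of a vector
  space whose dimension is the number of minimal positive solutions (\<open>card_generators_ge\<close>).
\<close>


section \<open>Hilbert bases and irreducible elements\<close>

definition irreducibles :: "'a::comm_monoid_add set \<Rightarrow> 'a set" where
  "irreducibles Q = {p \<in> Q. p \<noteq> 0 \<and> (\<forall>x\<in>Q. \<forall>y\<in>Q. p = x + y \<longrightarrow> x = 0 \<or> y = 0)}"

lemma semigroup_gen_add:
  assumes "x \<in> semigroup_gen H" and "y \<in> semigroup_gen H"
  shows "x + y \<in> semigroup_gen H"
  using assms(1)
proof induction
  case (add h x)
  then have "h + (x + y) \<in> semigroup_gen H" using semigroup_gen.add by blast
  then show ?case by (simp add: add.assoc)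
qed (simp add: assms(2))

lemma semigroup_gen_generator: "h \<in> H \<Longrightarrow> h \<in> semigroup_gen H"
  using semigroup_gen.add[OF _ semigroup_gen.zero, of h H] by simp

lemma irreducible_in_generators:
  assumes "p \<in> semigroup_gen H" and "p \<in> irreducibles (semigroup_gen H)"
  shows "p \<in> H"
  using assms
proof induction
  case zero
  then show ?case by (simp add: irreducibles_def)
next
  case (add h x)
  then have "h = 0 \<or> x = 0"
    by (auto simp: irreducibles_def dest: semigroup_gen_generator)
  then show ?case using add by auto
qed

text \<open>
  In a semigroup with an additive height that is positive away from \<open>0\<close>, splitting an element
  lowers the height, so repeated splitting ends in irreducible elements: they generate. An
  irreducible element cannot be a sum of other generators, so it lies in every generating set.
  The irreducible elements therefore form the smallest generating set, which is the only minimal one.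
\<close>

lemma hilbert_basis_eq_irreducibles:
  fixes Q :: "'a::comm_monoid_add set" and height :: "'a \<Rightarrow> nat"
  assumes zero: "0 \<in> Q" and add: "\<And>x y. x \<in> Q \<Longrightarrow> y \<in> Q \<Longrightarrow> x + y \<in> Q"
    and height_add: "\<And>x y. x \<in> Q \<Longrightarrow> y \<in> Q \<Longrightarrow> height (x + y) = height x + height y"
    and height_pos: "\<And>x. x \<in> Q \<Longrightarrow> x \<noteq> 0 \<Longrightarrow> 0 < height x"
    and fin: "finite (irreducibles Q)"
  shows "hilbert_basis Q = irreducibles Q"
proof -
  have "x \<in> Q" if "x \<in> semigroup_gen (irreducibles Q)" for x
    using that by induction (auto simp: zero irreducibles_def intro: add)
  moreover have "x \<in> semigroup_gen (irreducibles Q)" if "x \<in> Q" for x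
    using that
  proof (induction "height x" arbitrary: x rule: less_induct)
    case less
    consider "x = 0" | "x \<in> irreducibles Q"
      | y z where "y \<in> Q" "z \<in> Q" "x = y + z" "y \<noteq> 0" "z \<noteq> 0"
      using less.prems by (auto simp: irreducibles_def)
    then show ?case
    proof cases
      case 3
      then have "height y < height x" "height z < height x"
        using height_add[of y z] height_pos by force+
      then show ?thesis using less.hyps 3 by (auto intro: semigroup_gen_add)
    qed (auto intro: semigroup_gen.zero semigroup_gen_generator)
  qed
  ultimately have gen: "semigroup_gen (irreducibles Q) = Q" by blast
  have sub: "irreducibles Q \<subseteq> H" if "semigroup_gen H = Q" for H
    using irreducible_in_generators[of _ H] that by (auto simp: irreducibles_def)
  show ?thesis
    unfolding hilbert_basis_def
  proof (rule the_equality)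
    show "finite (irreducibles Q) \<and> semigroup_gen (irreducibles Q) = Q \<and>
        (\<forall>H'. H' \<subset> irreducibles Q \<longrightarrow> semigroup_gen H' \<noteq> Q)"
      using fin gen sub by blast
    show "H = irreducibles Q"
      if "finite H \<and> semigroup_gen H = Q \<and> (\<forall>H'. H' \<subset> H \<longrightarrow> semigroup_gen H' \<noteq> Q)" for H
      using that gen sub by (metis psubsetI)
  qed
qed


section \<open>The fan of a decreasing sequence of rays\<close>

text \<open>
  Ray \<open>i\<close> is spanned by \<open>(B i, A i)\<close>, and the rays turn from the vertical axis (\<open>i = 0\<close>) to
  the horizontal axis (\<open>i = n + 1\<close>). The condition \<open>1 \<le> n\<close> keeps the two axes out of a common
  cone.
\<close>

locale ray_fan =
  fixes n :: nat and A B :: "nat \<Rightarrow> int"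
  assumes n_pos: "1 \<le> n"
    and first_ray: "A 0 = 1" "B 0 = 0"
    and last_ray: "A (Suc n) = 0" "B (Suc n) = 1"
    and A_pos: "i \<le> n \<Longrightarrow> 0 < A i"
    and B_pos: "1 \<le> i \<Longrightarrow> i \<le> Suc n \<Longrightarrow> 0 < B i"
    and decreasing_step: "i \<le> n \<Longrightarrow> A (Suc i) * B i < A i * B (Suc i)"
begin

text \<open>
  The determinant of \<open>p\<close> with ray \<open>i\<close>: nonnegative for the points of the quadrant on or below
  the ray, zero on the ray. Cones are described by these integral inequalities, since
  additivity of \<open>side\<close> turns statements about sums of lattice points into sign arguments.
\<close>

definition side :: "nat \<Rightarrow> int \<times> int \<Rightarrow> int" where
  "side i p = A i * fst p - B i * snd p"

definition cone :: "nat \<Rightarrow> (int \<times> int) set" where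
  "cone i = {p. 0 \<le> side i p \<and> side (Suc i) p \<le> 0}"

abbreviation quadrant :: "(int \<times> int) set" where
  "quadrant \<equiv> {p. 0 \<le> fst p \<and> 0 \<le> snd p}"

lemma side_add [simp]: "side i (p + q) = side i p + side i q"
  by (simp add: side_def algebra_simps)

lemma side_diff [simp]: "side i (p - q) = side i p - side i q"
  by (simp add: side_def algebra_simps)

lemma side_zero [simp]: "side i 0 = 0"
  by (simp add: side_def)

lemma side_first [simp]: "side 0 p = fst p"
  by (simp add: side_def first_ray)

lemma side_last [simp]: "side (Suc n) p = - snd p"
  by (simp add: side_def last_ray)

lemma A_nonneg: "i \<le> Suc n \<Longrightarrow> 0 \<le> A i"
  using A_pos[of i] last_ray by (cases "i \<le> n") (auto simp: le_Suc_eq)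

lemma B_nonneg: "i \<le> Suc n \<Longrightarrow> 0 \<le> B i"
  using B_pos[of i] first_ray by (cases "i = 0") auto

lemma decreasing: "i < j \<Longrightarrow> j \<le> Suc n \<Longrightarrow> A j * B i < A i * B j"
proof (induction j)
  case (Suc j)
  show ?case
  proof (cases "i = j")
    case True
    then show ?thesis using decreasing_step Suc.prems by simp
  next
    case False
    then have ij: "i < j" and jn: "j \<le> n" using Suc.prems by auto
    have pos: "0 < B j" "0 < B (Suc j)" using B_pos ij jn by auto
    have "A (Suc j) * B i * B j = (A (Suc j) * B j) * B i" by simp
    also have "\<dots> \<le> (A j * B (Suc j)) * B i"
      using decreasing_step[OF jn] B_nonneg[of i] ij jn by (intro mult_right_mono) auto
    also have "\<dots> = (A j * B i) * B (Suc j)" by simp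
    also have "\<dots> < (A i * B j) * B (Suc j)"
      using Suc.IH ij jn pos by (intro mult_strict_right_mono) auto
    also have "\<dots> = A i * B (Suc j) * B j" by simp
    finally show ?thesis using pos by simp
  qed
qed simp

text \<open>
  A nonzero point of the quadrant on or below a ray is strictly below every steeper ray. Every comparison of
  different cones rests on this monotonicity of the signs of \<open>side i p\<close> in \<open>i\<close>.
\<close>

lemma side_pos_of_later:
  assumes p: "p \<in> quadrant" "p \<noteq> 0" and ij: "i < j" "j \<le> Suc n" and side: "0 \<le> side j p"
  shows "0 < side i p"
proof -
  have Bj: "0 < B j" using B_pos ij by auto
  have r: "0 < fst p"
  proof (rule ccontr)
    assume "\<not> 0 < fst p"
    then have "fst p = 0" "0 < snd p" using p by (auto simp: prod_eq_iff)
    then show False using side mult_pos_pos[OF Bj \<open>0 < snd p\<close>] by (simp add: side_def)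
  qed
  have "B j * (B i * snd p) = B i * (B j * snd p)" by simp
  also have "\<dots> \<le> B i * (A j * fst p)"
    using side B_nonneg[of i] ij by (intro mult_left_mono) (auto simp: side_def)
  also have "\<dots> = (A j * B i) * fst p" by simp
  also have "\<dots> < (A i * B j) * fst p"
    using decreasing ij r by (intro mult_strict_right_mono) auto
  also have "\<dots> = B j * (A i * fst p)" by simp
  finally show ?thesis using Bj by (simp add: side_def)
qed

text \<open>
  By Cramer's rule the coordinates of a point, multiplied by the determinant of the two bounding
  rays, are nonnegative combinations of its distances from these rays.
\<close>

lemma cone_subset_quadrant:
  assumes "i \<le> n" shows "cone i \<subseteq> quadrant"
proof
  fix p assume p: "p \<in> cone i"
  define D where "D = A i * B (Suc i) - A (Suc i) * B i"
  have D: "0 < D" using decreasing_step assms by (simp add: D_def)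
  have "D * fst p = B (Suc i) * side i p + B i * (- side (Suc i) p)"
    "D * snd p = A (Suc i) * side i p + A i * (- side (Suc i) p)"
    by (simp_all add: D_def side_def algebra_simps)
  moreover have "0 \<le> side i p" "0 \<le> - side (Suc i) p" using p by (auto simp: cone_def)
  moreover have "0 \<le> A i" "0 \<le> A (Suc i)" "0 \<le> B i" "0 \<le> B (Suc i)"
    using assms A_nonneg B_nonneg by auto
  ultimately have "0 \<le> D * fst p" "0 \<le> D * snd p"
    by (metis add_nonneg_nonneg mult_nonneg_nonneg)+
  then show "p \<in> quadrant" using D by (simp add: zero_le_mult_iff)
qed

lemma cone_zero: "0 \<in> cone i"
  by (simp add: cone_def)

lemma cone_add: "p \<in> cone i \<Longrightarrow> q \<in> cone i \<Longrightarrow> p + q \<in> cone i"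
  by (simp add: cone_def)

lemma quadrant_covered:
  assumes "p \<in> quadrant" shows "\<exists>i\<le>n. p \<in> cone i"
proof -
  define i where "i = (GREATEST i. i \<le> n \<and> 0 \<le> side i p)"
  have "0 \<le> n \<and> 0 \<le> side 0 p" using assms by simp
  then have i: "i \<le> n \<and> 0 \<le> side i p"
    unfolding i_def by (rule GreatestI_nat[where b = n]) auto
  have "side (Suc i) p \<le> 0"
  proof (cases "i = n")
    case True
    then show ?thesis using assms by simp
  next
    case False
    have "\<not> (Suc i \<le> n \<and> 0 \<le> side (Suc i) p)"
      using Greatest_le_nat[of "\<lambda>i. i \<le> n \<and> 0 \<le> side i p" "Suc i" n] by (auto simp: i_def)
    then show ?thesis using False i by simp
  qed
  then show ?thesis using i by (auto simp: cone_def)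
qed

text \<open>
  Two points are cosigned when no inner ray separates them strictly. Separation is the only
  obstruction to equality in \<open>max u v + max u' v' \<ge> max (u + u') (v + v')\<close>, which is how this
  relation enters the study of positive solutions.
\<close>

definition cosigned :: "int \<times> int \<Rightarrow> int \<times> int \<Rightarrow> bool" where
  "cosigned p q \<longleftrightarrow> (\<forall>i\<in>{1..n}. 0 \<le> side i p \<and> 0 \<le> side i q \<or> side i p \<le> 0 \<and> side i q \<le> 0)"

text \<open>
  For cosigned points \<open>side i\<close> of the sum has a sign only if both summands have it, so every cone
  that contains the sum contains both summands.
\<close>

lemma cosigned_cone_sum:
  assumes "p \<in> quadrant" "q \<in> quadrant" "cosigned p q" "i \<le> n" "p + q \<in> cone i"
  shows "p \<in> cone i \<and> q \<in> cone i"
proof -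
  have "0 \<le> side i p \<and> 0 \<le> side i q"
  proof (cases "i = 0")
    case False
    then show ?thesis using assms by (force simp: cosigned_def cone_def)
  qed (use assms in simp)
  moreover have "side (Suc i) p \<le> 0 \<and> side (Suc i) q \<le> 0"
  proof (cases "i = n")
    case False
    then have "Suc i \<in> {1..n}" using assms by auto
    then show ?thesis using assms by (force simp: cosigned_def cone_def)
  qed (use assms in simp)
  ultimately show ?thesis by (simp add: cone_def)
qed

lemma cosigned_iff_common_cone:
  assumes "p \<in> quadrant" "q \<in> quadrant"
  shows "cosigned p q \<longleftrightarrow> (\<exists>i\<le>n. p \<in> cone i \<and> q \<in> cone i)"
proof
  assume "cosigned p q"
  then show "\<exists>i\<le>n. p \<in> cone i \<and> q \<in> cone i"
    using quadrant_covered[of "p + q"] cosigned_cone_sum[OF assms] assms by fastforce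
next
  assume "\<exists>i\<le>n. p \<in> cone i \<and> q \<in> cone i"
  then obtain i where i: "i \<le> n" "p \<in> cone i" "q \<in> cone i" by blast
  have *: "(j \<le> i \<longrightarrow> 0 \<le> side j x) \<and> (i < j \<longrightarrow> side j x \<le> 0)"
    if "x \<in> cone i" "x \<in> quadrant" "j \<in> {1..n}" for x j
  proof (cases "x = 0")
    case False
    have "0 \<le> side j x" if "j \<le> i"
      using side_pos_of_later[of x j i] that i \<open>x \<in> cone i\<close> \<open>x \<in> quadrant\<close> False
      by (cases "j = i") (auto simp: cone_def)
    moreover have "side j x \<le> 0" if "i < j"
    proof (rule ccontr)
      assume neg: "\<not> side j x \<le> 0"
      then have "j \<noteq> Suc i" using \<open>x \<in> cone i\<close> by (auto simp: cone_def)
      then have "0 < side (Suc i) x"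
        using neg that \<open>x \<in> quadrant\<close> \<open>j \<in> {1..n}\<close> False
        by (intro side_pos_of_later[of x "Suc i" j]) auto
      then show False using \<open>x \<in> cone i\<close> by (simp add: cone_def)
    qed
    ultimately show ?thesis by simp
  qed simp
  show "cosigned p q"
    unfolding cosigned_def using *[OF i(2) assms(1)] *[OF i(3) assms(2)] by (meson not_le)
qed

text \<open>
  An irreducible element other than the two ray generators \<open>u\<close> and \<open>v\<close> leaves the cone when
  \<open>u\<close> or \<open>v\<close> is subtracted. This bounds both its \<open>side\<close> values by the determinant \<open>D\<close>, and the
  two values determine the point.
\<close>

lemma finite_irreducibles_cone:
  assumes i: "i \<le> n" shows "finite (irreducibles (cone i))"
proof -
  define u v where "u = (B i, A i)" and "v = (B (Suc i), A (Suc i))"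
  define D where "D = A i * B (Suc i) - A (Suc i) * B i"
  have D: "0 < D" using decreasing_step assms by (simp add: D_def)
  have side_uv: "side i u = 0" "side (Suc i) u = - D" "side i v = D" "side (Suc i) v = 0"
    by (simp_all add: u_def v_def D_def side_def algebra_simps)
  then have uv: "u \<in> cone i" "v \<in> cone i" "u \<noteq> 0" "v \<noteq> 0"
    using D by (auto simp: cone_def)
  define f where "f p = (side i p, side (Suc i) p)" for p
  have inj: "inj f"
  proof (rule injI)
    fix p q assume "f p = f q"
    then have "side i (p - q) = 0" "side (Suc i) (p - q) = 0" by (simp_all add: f_def)
    moreover have "D * fst (p - q) = B (Suc i) * side i (p - q) + B i * (- side (Suc i) (p - q))"
      "D * snd (p - q) = A (Suc i) * side i (p - q) + A i * (- side (Suc i) (p - q))"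
      unfolding D_def side_def by (simp_all add: algebra_simps)
    ultimately have "D * fst (p - q) = 0" "D * snd (p - q) = 0" by simp_all
    then show "p = q" using D by (simp add: prod_eq_iff)
  qed
  have "irreducibles (cone i) \<subseteq> {u, v} \<union> f -` ({0..D} \<times> {-D..0})"
  proof
    fix p assume p: "p \<in> irreducibles (cone i)"
    then have pc: "p \<in> cone i" by (simp add: irreducibles_def)
    have "w = p" if "w \<in> {u, v}" "p - w \<in> cone i" for w
    proof -
      have "p = w + (p - w)" by simp
      then have "w = 0 \<or> p - w = 0"
        using p that uv unfolding irreducibles_def by blast
      then show ?thesis using that uv by auto
    qed
    then have "p \<in> {u, v} \<or> p - u \<notin> cone i \<and> p - v \<notin> cone i" by blast
    then show "p \<in> {u, v} \<union> f -` ({0..D} \<times> {-D..0})"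
      using pc side_uv by (auto simp: cone_def f_def)
  qed
  moreover have "finite (f -` ({0..D} \<times> {-D..0}))"
    using inj by (intro finite_vimageI) auto
  ultimately show ?thesis by (auto intro: finite_subset)
qed

lemma hilbert_basis_cone:
  assumes "i \<le> n" shows "hilbert_basis (cone i) = irreducibles (cone i)"
proof (rule hilbert_basis_eq_irreducibles[where height = "\<lambda>p. nat (fst p + snd p)"])
  fix p q assume p: "p \<in> cone i"
  then have pq: "p \<in> quadrant" using cone_subset_quadrant assms by auto
  then show "0 < nat (fst p + snd p)" if "p \<noteq> 0" using that by (auto simp: prod_eq_iff)
  assume q: "q \<in> cone i"
  then show "p + q \<in> cone i" using p by (rule cone_add[rotated])
  have "q \<in> quadrant" using cone_subset_quadrant q assms by auto
  then show "nat (fst (p + q) + snd (p + q)) = nat (fst p + snd p) + nat (fst q + snd q)"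
    using pq by (simp add: nat_add_distrib[symmetric] algebra_simps)
qed (use assms finite_irreducibles_cone cone_zero in auto)

lemma irreducible_cosigned_sum:
  assumes x: "x \<in> quadrant" "x \<noteq> 0" and y: "y \<in> quadrant" "y \<noteq> 0"
    and p: "x + y \<in> irreducibles (cone j)" "j \<le> n"
  shows "\<not> cosigned x y"
proof
  assume "cosigned x y"
  then have "x \<in> cone j" "y \<in> cone j"
    using cosigned_cone_sum x y p by (auto simp: irreducibles_def)
  then show False using p x y by (auto simp: irreducibles_def)
qed

text \<open>
  A point in two adjacent cones lies on their common ray, whose lattice points are the
  multiples of one primitive vector \<open>w\<close>; only \<open>w\<close> itself can be irreducible. It is irreducible
  in both cones because the common ray is a face: on either side, two summands of \<open>w\<close> have
  \<open>side\<close> values of equal sign adding up to \<open>0\<close>, and so lie on the ray themselves.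
\<close>

lemma irreducibles_adjacent:
  assumes "k < n"
  shows "\<exists>w. irreducibles (cone k) \<inter> irreducibles (cone (Suc k)) = {w}"
proof -
  define g where "g = gcd (A (Suc k)) (B (Suc k))"
  have pos: "0 < A (Suc k)" "0 < B (Suc k)" using A_pos B_pos assms by auto
  then have g: "0 < g" by (simp add: g_def)
  define \<alpha> \<beta> where "\<alpha> = A (Suc k) div g" and "\<beta> = B (Suc k) div g"
  have AB: "A (Suc k) = g * \<alpha>" "B (Suc k) = g * \<beta>"
    by (simp_all add: \<alpha>_def \<beta>_def g_def)
  have \<alpha>\<beta>: "0 < \<alpha>" "0 < \<beta>" using pos g by (auto simp: AB zero_less_mult_iff)
  have cop: "coprime \<alpha> \<beta>"
    using pos by (auto simp: \<alpha>_def \<beta>_def g_def intro!: div_gcd_coprime)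
  have side_eq: "side (Suc k) p = g * (\<alpha> * fst p - \<beta> * snd p)" for p
    by (simp add: side_def AB algebra_simps)
  have on_ray: "\<exists>t. p = (t * \<beta>, t * \<alpha>)" if "side (Suc k) p = 0" for p
  proof -
    have eq: "\<alpha> * fst p = \<beta> * snd p" using that g by (simp add: side_eq)
    then have "\<beta> dvd fst p"
      using cop by (metis coprime_commute coprime_dvd_mult_right_iff dvd_triv_left)
    then obtain t where t: "fst p = \<beta> * t" by blast
    then have "snd p = \<alpha> * t" using eq \<alpha>\<beta> by (simp add: algebra_simps)
    then show ?thesis using t by (auto simp: prod_eq_iff)
  qed
  define w where "w = (\<beta>, \<alpha>)"
  have w: "w \<in> quadrant" "w \<noteq> 0" using \<alpha>\<beta> by (auto simp: w_def zero_prod_def)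
  have sw: "side (Suc k) w = 0" by (simp add: side_eq w_def)
  have ray_in: "p \<in> cone k \<inter> cone (Suc k)" if "side (Suc k) p = 0" "p \<in> quadrant" for p
  proof -
    have "p \<noteq> 0 \<Longrightarrow> 0 < side k p"
      using that assms by (intro side_pos_of_later[of p k "Suc k"]) auto
    moreover have "p \<noteq> 0 \<Longrightarrow> \<not> 0 \<le> side (Suc (Suc k)) p"
      using side_pos_of_later[of p "Suc k" "Suc (Suc k)"] that assms by auto
    ultimately show ?thesis using that by (cases "p = 0") (auto simp: cone_def)
  qed
  \<comment> \<open>The sign \<open>\<epsilon>\<close> covers the cone below the ray (\<open>1\<close>) and the cone above it (\<open>-1\<close>) at once.\<close>
  have w_irred: "w \<in> irreducibles Q"
    if Q: "w \<in> Q" "Q \<subseteq> quadrant" "\<And>x. x \<in> Q \<Longrightarrow> 0 \<le> \<epsilon> * side (Suc k) x" "\<epsilon> = 1 \<or> \<epsilon> = -1"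
    for Q and \<epsilon> :: int
  proof -
    have "x = 0 \<or> y = 0" if xy: "x \<in> Q" "y \<in> Q" "w = x + y" for x y
    proof -
      have "side (Suc k) x + side (Suc k) y = 0" using sw xy by simp
      then have "side (Suc k) x = 0" "side (Suc k) y = 0"
        using Q(3)[OF xy(1)] Q(3)[OF xy(2)] Q(4) by auto
      then obtain s t where st: "x = (s * \<beta>, s * \<alpha>)" "y = (t * \<beta>, t * \<alpha>)"
        using on_ray by blast
      have "0 \<le> s" "0 \<le> t"
        using xy Q(2) st \<alpha>\<beta> by (auto simp: zero_le_mult_iff)
      moreover have "s + t = 1"
      proof -
        have "(s + t) * \<beta> = 1 * \<beta>" using xy(3) st by (simp add: w_def algebra_simps)
        then show ?thesis using \<alpha>\<beta> by (simp only: mult_cancel_right) simp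
      qed
      ultimately have "s = 0 \<or> t = 0" by linarith
      then show ?thesis using st by (auto simp: zero_prod_def)
    qed
    then show ?thesis using Q w by (auto simp: irreducibles_def)
  qed
  have "w \<in> irreducibles (cone k)"
    using ray_in[OF sw w(1)] cone_subset_quadrant[of k] assms
    by (intro w_irred[where \<epsilon> = "-1"]) (auto simp: cone_def)
  moreover have "w \<in> irreducibles (cone (Suc k))"
    using ray_in[OF sw w(1)] cone_subset_quadrant[of "Suc k"] assms
    by (intro w_irred[where \<epsilon> = 1]) (auto simp: cone_def)
  moreover have "p = w" if p: "p \<in> irreducibles (cone k)" "p \<in> irreducibles (cone (Suc k))" for p
  proof -
    have s: "side (Suc k) p = 0" using p by (auto simp: irreducibles_def cone_def)
    then obtain t where t: "p = (t * \<beta>, t * \<alpha>)" using on_ray by blast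
    have "p \<in> quadrant" "p \<noteq> 0" using p cone_subset_quadrant[of k] assms by (auto simp: irreducibles_def)
    then have "0 < t" using t \<alpha>\<beta> by (auto simp: zero_le_mult_iff zero_prod_def)
    define q where "q = ((t - 1) * \<beta>, (t - 1) * \<alpha>)"
    have "q \<in> quadrant" "side (Suc k) q = 0" "p = w + q"
      using \<open>0 < t\<close> \<alpha>\<beta> by (auto simp: q_def side_eq w_def t algebra_simps)
    then have "q \<in> cone k" "w \<in> cone k" "p = w + q" using ray_in sw w by auto
    then have "q = 0" using p w by (auto simp: irreducibles_def)
    then show ?thesis using \<open>p = w + q\<close> by simp
  qed
  ultimately show ?thesis by blast
qed

lemma irreducibles_distant:
  assumes "i < j" "j < k" "k \<le> n"
  shows "irreducibles (cone i) \<inter> irreducibles (cone k) = {}"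
proof -
  have False if "p \<in> irreducibles (cone i)" "p \<in> irreducibles (cone k)" for p
    using that side_pos_of_later[of p "Suc i" k] cone_subset_quadrant[of k] assms
    by (auto simp: irreducibles_def cone_def)
  then show ?thesis by blast
qed

text \<open>
  Adding cone \<open>k + 1\<close> to the union meets the earlier cones in exactly one irreducible
  element, the primitive vector on the ray shared with cone \<open>k\<close>.
\<close>

lemma card_union_irreducibles:
  assumes "k \<le> n"
  shows "int (card (\<Union>i\<le>k. irreducibles (cone i))) = (\<Sum>i\<le>k. int (card (irreducibles (cone i)))) - int k"
  using assms
proof (induction k)
  case (Suc k)
  let ?I = "\<lambda>i. irreducibles (cone i)"
  have fin: "finite (\<Union>i\<le>k. ?I i)" "finite (?I (Suc k))"
    using Suc.prems by (auto intro!: finite_irreducibles_cone)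
  have "(\<Union>i\<le>k. ?I i) \<inter> ?I (Suc k) = ?I k \<inter> ?I (Suc k)"
  proof (intro equalityI subsetI)
    fix p assume "p \<in> (\<Union>i\<le>k. ?I i) \<inter> ?I (Suc k)"
    then obtain i where i: "i \<le> k" "p \<in> ?I i" "p \<in> ?I (Suc k)" by blast
    then have "\<not> i < k" using irreducibles_distant[of i k "Suc k"] Suc.prems by blast
    then show "p \<in> ?I k \<inter> ?I (Suc k)" using i by simp
  qed auto
  then have "card ((\<Union>i\<le>k. ?I i) \<inter> ?I (Suc k)) = 1"
    using irreducibles_adjacent[of k] Suc.prems by auto
  moreover have "(\<Union>i\<le>Suc k. ?I i) = (\<Union>i\<le>k. ?I i) \<union> ?I (Suc k)"
    by (auto simp: le_Suc_eq)
  ultimately show ?case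
    using card_Un_Int[OF fin] Suc by simp
qed simp

text \<open>
  The shadow of minimality in the plane of \<open>(r, s)\<close>: a point with positive coordinates from which
  no nonzero cosigned vector can be split off so that the remainder \<open>x\<close> still has positive
  coordinates. Only \<open>x\<close> has to be positive; \<open>y\<close> may lie on an axis.
\<close>

definition minimal_points :: "(int \<times> int) set" where
  "minimal_points = {p. 0 < fst p \<and> 0 < snd p \<and>
    (\<forall>x y. p = x + y \<and> y \<in> quadrant \<and> 0 < fst x \<and> 0 < snd x \<and> cosigned x y \<longrightarrow> y = 0)}"

lemma axis_points:
  assumes "p \<in> cone i" "i \<le> n" "p \<noteq> 0"
  shows "fst p = 0 \<Longrightarrow> i = 0" and "snd p = 0 \<Longrightarrow> i = n"
proof -
  have p: "p \<in> quadrant" using assms cone_subset_quadrant by auto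
  show "i = 0" if "fst p = 0"
  proof (rule ccontr)
    assume "i \<noteq> 0"
    then have "0 < B i" using B_pos assms by auto
    moreover have "0 < snd p" using that p assms by (auto simp: prod_eq_iff)
    ultimately have "side i p < 0" using that by (simp add: side_def)
    then show False using assms by (simp add: cone_def)
  qed
  show "i = n" if "snd p = 0"
  proof (rule ccontr)
    assume "i \<noteq> n"
    then have "0 < A (Suc i)" using A_pos assms by auto
    moreover have "0 < fst p" using that p assms by (auto simp: prod_eq_iff)
    ultimately have "0 < side (Suc i) p" using that by (simp add: side_def)
    then show False using assms by (simp add: cone_def)
  qed
qed

lemma unit_vectors_irreducible: "(0, 1) \<in> irreducibles (cone 0)" "(1, 0) \<in> irreducibles (cone n)"
proof -
  have *: "x = 0 \<or> y = 0"
    if "x \<in> quadrant" "y \<in> quadrant" "p = x + y" "p = (0, 1) \<or> p = (1, 0)" for p x y :: "int \<times> int"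
    using that by (cases x; cases y) (auto simp: zero_prod_def)
  have nz: "(0, 1) \<noteq> (0 :: int \<times> int)" "(1, 0) \<noteq> (0 :: int \<times> int)"
    by (simp_all add: zero_prod_def)
  have "(0, 1) \<in> cone 0"
    using B_pos[of 1] by (simp add: cone_def side_def first_ray)
  then show "(0, 1) \<in> irreducibles (cone 0)"
    using cone_subset_quadrant[of 0] * nz unfolding irreducibles_def by blast
  have "(1, 0) \<in> cone n"
    using A_pos[of n] by (simp add: cone_def side_def last_ray)
  then show "(1, 0) \<in> irreducibles (cone n)"
    using cone_subset_quadrant[of n] * nz unfolding irreducibles_def by blast
qed

text \<open>
  Cosigned splittings of \<open>p\<close> are splittings inside a cone that contains \<open>p\<close>, so it remains to
  compare the conditions on positivity. A nonzero element of a cone that is not positive lies on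
  an axis; as no cone meets both axes outside \<open>0\<close>, one summand of a positive point is always
  positive. Conversely the only irreducible elements on the axes are the unit vectors.
\<close>

lemma minimal_points_eq:
  "minimal_points = (\<Union>i\<le>n. irreducibles (cone i)) - {(0, 1), (1, 0)}"
proof (intro equalityI subsetI)
  fix p assume p: "p \<in> minimal_points"
  then have pos: "0 < fst p" "0 < snd p" by (auto simp: minimal_points_def)
  then obtain j where j: "j \<le> n" "p \<in> cone j" using quadrant_covered[of p] by auto
  have "x = 0 \<or> y = 0" if xy: "x \<in> cone j" "y \<in> cone j" "p = x + y" for x y
  proof (rule ccontr)
    assume nz: "\<not> (x = 0 \<or> y = 0)"
    have xy_quad: "x \<in> quadrant" "y \<in> quadrant" using xy j cone_subset_quadrant by auto
    then have cs: "cosigned x y" "cosigned y x"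
      using cosigned_iff_common_cone xy j by auto
    have split: "v = 0"
      if "p = u + v" "v \<in> quadrant" "0 < fst u" "0 < snd u" "cosigned u v" for u v
      using p that unfolding minimal_points_def mem_Collect_eq by blast
    have "\<not> (0 < fst x \<and> 0 < snd x)" "\<not> (0 < fst y \<and> 0 < snd y)"
      using split[of x y] split[of y x] xy(3) xy_quad nz cs add.commute[of x y] by metis+
    then have "(fst x = 0 \<and> snd y = 0) \<or> (snd x = 0 \<and> fst y = 0)"
      using xy_quad pos xy(3) by auto
    then show False
      using axis_points[OF xy(1) j(1)] axis_points[OF xy(2) j(1)] nz n_pos by auto
  qed
  then have "p \<in> irreducibles (cone j)" using j pos by (auto simp: irreducibles_def)
  then show "p \<in> (\<Union>i\<le>n. irreducibles (cone i)) - {(0, 1), (1, 0)}" using j pos by auto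
next
  fix p assume "p \<in> (\<Union>i\<le>n. irreducibles (cone i)) - {(0, 1), (1, 0)}"
  then obtain j where j: "j \<le> n" "p \<in> irreducibles (cone j)" and ne: "p \<noteq> (0, 1)" "p \<noteq> (1, 0)"
    by auto
  have pc: "p \<in> cone j" "p \<noteq> 0" using j by (auto simp: irreducibles_def)
  then have pq: "p \<in> quadrant" using cone_subset_quadrant j by auto
  have no_split: "y = 0" if "p = x + y" "x \<in> quadrant" "x \<noteq> 0" "y \<in> quadrant" "cosigned x y" for x y
    using irreducible_cosigned_sum[of x y j] that j by auto
  have "p = e"
    if e: "e \<in> cone j" "e \<in> quadrant" "e \<noteq> 0" "p - e \<in> cone j" "p - e \<in> quadrant" for e
    using no_split[of e "p - e"] e j cosigned_iff_common_cone[of e "p - e"] by auto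
  note unit = this
  have "fst p \<noteq> 0"
  proof
    assume r: "fst p = 0"
    then have "j = 0" using axis_points pc j by blast
    moreover have "0 < snd p" using r pq pc by (auto simp: prod_eq_iff)
    moreover have "0 < B 1" using B_pos by auto
    ultimately have "p = (0, 1)"
      using r unit_vectors_irreducible(1)
      by (intro unit) (auto simp: irreducibles_def cone_def side_def first_ray zero_prod_def)
    then show False using ne by simp
  qed
  moreover have "snd p \<noteq> 0"
  proof
    assume s: "snd p = 0"
    then have "j = n" using axis_points pc j by blast
    moreover have "0 < fst p" using s pq pc by (auto simp: prod_eq_iff)
    moreover have "0 < A n" using A_pos by auto
    ultimately have "p = (1, 0)"
      using s unit_vectors_irreducible(2)
      by (intro unit) (auto simp: irreducibles_def cone_def side_def last_ray zero_prod_def)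
    then show False using ne by simp
  qed
  ultimately have pos: "0 < fst p" "0 < snd p" using pq by auto
  have "y = 0" if "p = x + y \<and> y \<in> quadrant \<and> 0 < fst x \<and> 0 < snd x \<and> cosigned x y" for x y
    using no_split[of x y] that by fastforce
  then show "p \<in> minimal_points"
    unfolding minimal_points_def mem_Collect_eq using pos by blast
qed

lemma finite_minimal_points: "finite minimal_points"
  unfolding minimal_points_eq by (auto intro!: finite_irreducibles_cone)

lemma card_minimal_points:
  "int (card minimal_points) = (\<Sum>i=0..n. int (card (hilbert_basis (cone i)))) - (int n + 2)"
proof -
  let ?U = "\<Union>i\<le>n. irreducibles (cone i)"
  have sub: "{(0, 1), (1, 0)} \<subseteq> ?U" using unit_vectors_irreducible by auto
  have fin: "finite ?U" by (auto intro!: finite_irreducibles_cone)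
  have "card {(0, 1), (1, 0) :: int \<times> int} \<le> card ?U" by (rule card_mono[OF fin sub])
  then have "int (card minimal_points) = int (card ?U) - 2"
    unfolding minimal_points_eq using card_Diff_subset[OF _ sub] by (simp add: of_nat_diff)
  then show ?thesis
    using card_union_irreducibles[of n] hilbert_basis_cone by (simp add: atLeast0AtMost)
qed

end


section \<open>Subrings and their ideals\<close>

lemma ring_on_simps [simp]:
  "carrier (ring_on S) = S" "x \<otimes>\<^bsub>ring_on S\<^esub> y = x * y" "\<one>\<^bsub>ring_on S\<^esub> = 1"
  "x \<oplus>\<^bsub>ring_on S\<^esub> y = x + y" "\<zero>\<^bsub>ring_on S\<^esub> = 0"
  by (simp_all add: ring_on_def)

lemma cring_ring_on:
  fixes S :: "'r::comm_ring_1 set"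
  assumes "0 \<in> S" "1 \<in> S" "\<And>x. x \<in> S \<Longrightarrow> - x \<in> S"
    and "\<And>x y. x \<in> S \<Longrightarrow> y \<in> S \<Longrightarrow> x + y \<in> S" "\<And>x y. x \<in> S \<Longrightarrow> y \<in> S \<Longrightarrow> x * y \<in> S"
  shows "cring (ring_on S)"
proof (rule cringI)
  show "abelian_group (ring_on S)"
  proof (rule abelian_groupI)
    fix x assume "x \<in> carrier (ring_on S)"
    then show "\<exists>y\<in>carrier (ring_on S). y \<oplus>\<^bsub>ring_on S\<^esub> x = \<zero>\<^bsub>ring_on S\<^esub>"
      using assms(3) by (intro bexI[of _ "- x"]) auto
  qed (use assms in \<open>auto simp: algebra_simps\<close>)
  show "comm_monoid (ring_on S)"
    by (rule comm_monoidI) (use assms in \<open>auto simp: algebra_simps\<close>)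
qed (simp add: algebra_simps)

lemma ideal_ring_on:
  assumes R: "cring (ring_on S)" and "I \<subseteq> S" "0 \<in> I"
    and add: "\<And>x y. x \<in> I \<Longrightarrow> y \<in> I \<Longrightarrow> x + y \<in> I"
    and mult: "\<And>f x. f \<in> S \<Longrightarrow> x \<in> I \<Longrightarrow> f * x \<in> I"
  shows "ideal I (ring_on S)"
proof -
  interpret cring "ring_on S" by (rule R)
  have neg: "\<ominus>\<^bsub>ring_on S\<^esub> x = - x" if "x \<in> S" for x
  proof -
    have "\<ominus>\<^bsub>ring_on S\<^esub> x + x = 0" using l_neg[of x] that by simp
    then show ?thesis by (simp add: eq_neg_iff_add_eq_0)
  qed
  have "- 1 \<in> S" using neg[of 1] a_inv_closed[of 1] one_closed by simp
  then have neg_mem: "- x \<in> I" if "x \<in> I" for x using mult[of "- 1" x] that by simp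
  show ?thesis
  proof (rule idealI)
    show "subgroup I (add_monoid (ring_on S))"
    proof (rule add.subgroupI)
      fix x assume "x \<in> I"
      then show "\<ominus>\<^bsub>ring_on S\<^esub> x \<in> I"
        using neg[of x] neg_mem \<open>I \<subseteq> S\<close> by auto
    next
      show "I \<subseteq> carrier (ring_on S)" "I \<noteq> {}" using assms by auto
      show "x \<oplus>\<^bsub>ring_on S\<^esub> y \<in> I" if "x \<in> I" "y \<in> I" for x y
        using add[OF that] by simp
    qed
    show "x \<otimes>\<^bsub>ring_on S\<^esub> y \<in> I" "y \<otimes>\<^bsub>ring_on S\<^esub> x \<in> I"
      if "y \<in> I" "x \<in> carrier (ring_on S)" for x y
      using mult[of x y] that by (simp_all add: mult.commute)
  qed (rule ring_axioms)
qed


section \<open>Subspaces spanned by monomials\<close>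

text \<open>
  An iterated polynomial in \<open>k[x][u, v]\<close> is treated as a combination of monomials indexed by pairs
  of exponents, the first for the outer variables and the second for the inner ones.
\<close>

definition bcoeff :: "('a \<Rightarrow>\<^sub>0 'b \<Rightarrow>\<^sub>0 'c::zero) \<Rightarrow> 'a \<times> 'b \<Rightarrow> 'c" where
  "bcoeff f x = Poly_Mapping.lookup (Poly_Mapping.lookup f (fst x)) (snd x)"

definition bmonom :: "'a \<times> 'b \<Rightarrow> 'c::zero \<Rightarrow> ('a \<Rightarrow>\<^sub>0 'b \<Rightarrow>\<^sub>0 'c)" where
  "bmonom x c = Poly_Mapping.single (fst x) (Poly_Mapping.single (snd x) c)"

definition monomial_span :: "('a \<times> 'b) set \<Rightarrow> ('a \<Rightarrow>\<^sub>0 'b \<Rightarrow>\<^sub>0 'c::zero) set" where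
  "monomial_span X = {f. \<forall>x. bcoeff f x \<noteq> 0 \<longrightarrow> x \<in> X}"

lemma bcoeff_eqI:
  assumes "\<And>x. bcoeff f x = bcoeff g x" shows "f = g"
proof (intro poly_mapping_eqI)
  fix p m show "Poly_Mapping.lookup (Poly_Mapping.lookup f p) m = Poly_Mapping.lookup (Poly_Mapping.lookup g p) m"
    using assms[of "(p, m)"] by (simp add: bcoeff_def)
qed

lemma bcoeff_zero [simp]: "bcoeff 0 x = 0"
  by (simp add: bcoeff_def)

lemma bcoeff_add [simp]: "bcoeff (f + g) x = bcoeff f x + bcoeff g x"
  by (simp add: bcoeff_def lookup_add)

lemma bcoeff_uminus [simp]: "bcoeff (- f) x = - bcoeff f (x :: 'a \<times> 'b)"
  for f :: "'a \<Rightarrow>\<^sub>0 'b \<Rightarrow>\<^sub>0 'c::ab_group_add"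
  by (simp add: bcoeff_def)

lemma bcoeff_sum: "bcoeff (sum h A) x = (\<Sum>a\<in>A. bcoeff (h a) x)"
  by (simp add: bcoeff_def lookup_sum)

lemma bcoeff_bmonom: "bcoeff (bmonom y c) x = (if x = y then c else 0)"
  by (auto simp: bcoeff_def bmonom_def lookup_single when_def prod_eq_iff)

lemma bmonom_mult: "bmonom x c * bmonom y d = bmonom (x + y) (c * d)"
  by (simp add: bmonom_def mult_single)

lemma bmonom_add: "bmonom x (c + d) = bmonom x c + bmonom x d"
  by (simp add: bmonom_def single_add)

lemma bmonom_one: "bmonom 0 1 = 1"
  by (simp add: bmonom_def)

lemma bmonom_zero [simp]: "bmonom x 0 = 0"
  by (simp add: bmonom_def)

lemma finite_bcoeff: "finite {x. bcoeff f x \<noteq> 0}"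
proof (rule finite_subset)
  show "{x. bcoeff f x \<noteq> 0} \<subseteq>
      (SIGMA p:Poly_Mapping.keys f. Poly_Mapping.keys (Poly_Mapping.lookup f p))"
    by (auto simp: bcoeff_def in_keys_iff)
qed auto

lemma bmonom_expansion: "f = (\<Sum>x | bcoeff f x \<noteq> 0. bmonom x (bcoeff f x))"
  by (rule bcoeff_eqI) (simp add: bcoeff_sum bcoeff_bmonom sum.delta'[OF finite_bcoeff])

lemma monomial_span_bmonom: "x \<in> X \<Longrightarrow> bmonom x c \<in> monomial_span X"
  by (simp add: monomial_span_def bcoeff_bmonom)

lemma monomial_span_zero: "0 \<in> monomial_span X"
  by (simp add: monomial_span_def)

lemma monomial_span_add: "f \<in> monomial_span X \<Longrightarrow> g \<in> monomial_span X \<Longrightarrow> f + g \<in> monomial_span X"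
  by (force simp: monomial_span_def)

lemma monomial_span_uminus: "f \<in> monomial_span X \<Longrightarrow> - f \<in> monomial_span X"
  for f :: "'a \<Rightarrow>\<^sub>0 'b \<Rightarrow>\<^sub>0 'c::ab_group_add"
  by (simp add: monomial_span_def)

lemma monomial_span_induct [consumes 1, case_names zero add]:
  fixes f :: "'a \<Rightarrow>\<^sub>0 'b \<Rightarrow>\<^sub>0 'c::comm_monoid_add"
  assumes "f \<in> monomial_span X" and "P 0"
    and step: "\<And>x c g. x \<in> X \<Longrightarrow> P g \<Longrightarrow> P (bmonom x c + g)"
  shows "P f"
proof -
  have "P (\<Sum>x\<in>F. bmonom x (bcoeff f x))" if "finite F" "F \<subseteq> X" for F
    using that by (induction F rule: finite_induct) (auto intro: step \<open>P 0\<close>)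
  moreover have "{x. bcoeff f x \<noteq> 0} \<subseteq> X" using assms(1) by (auto simp: monomial_span_def)
  ultimately have "P (\<Sum>x | bcoeff f x \<noteq> 0. bmonom x (bcoeff f x))"
    using finite_bcoeff by blast
  then show ?thesis unfolding bmonom_expansion[of f, symmetric] .
qed

lemma monomial_span_mult:
  fixes f g :: "'a::monoid_add \<Rightarrow>\<^sub>0 'b::monoid_add \<Rightarrow>\<^sub>0 'c::semiring_0"
  assumes f: "f \<in> monomial_span X" and g: "g \<in> monomial_span Y"
    and sum: "\<And>x y. x \<in> X \<Longrightarrow> y \<in> Y \<Longrightarrow> x + y \<in> Z"
  shows "f * g \<in> monomial_span Z"
  using f
proof (induction rule: monomial_span_induct)
  case (add x c h)
  have "bmonom x c * g \<in> monomial_span Z"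
    using g by (induction rule: monomial_span_induct)
      (auto simp: distrib_left bmonom_mult monomial_span_zero
        intro!: monomial_span_add monomial_span_bmonom sum add.hyps)
  then show ?case using add.IH by (simp add: distrib_right monomial_span_add)
qed (simp add: monomial_span_zero)

lemma cring_monomial_span:
  fixes E :: "('a::comm_monoid_add \<times> 'b::comm_monoid_add) set"
  assumes "0 \<in> E" "\<And>x y. x \<in> E \<Longrightarrow> y \<in> E \<Longrightarrow> x + y \<in> E"
  shows "cring (ring_on (monomial_span E :: ('a \<Rightarrow>\<^sub>0 'b \<Rightarrow>\<^sub>0 'c::comm_ring_1) set))"
proof (rule cring_ring_on)
  show "1 \<in> (monomial_span E :: ('a \<Rightarrow>\<^sub>0 'b \<Rightarrow>\<^sub>0 'c) set)"
    unfolding bmonom_one[symmetric] using assms(1) by (rule monomial_span_bmonom)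
qed (use assms in \<open>auto intro: monomial_span_zero monomial_span_add monomial_span_uminus monomial_span_mult\<close>)

text \<open>
  Scalars act as constant polynomials. This vector space structure makes the exchange lemma
  available for counting generators.
\<close>

lemma vector_space_bmonom:
  "vector_space (\<lambda>c f. bmonom 0 c * f ::
    ('a::comm_monoid_add \<Rightarrow>\<^sub>0 'b::comm_monoid_add \<Rightarrow>\<^sub>0 'c::field))"
  by unfold_locales
    (simp_all add: distrib_left bmonom_add distrib_right mult.assoc[symmetric] bmonom_mult bmonom_one)

lemma bcoeff_scale:
  fixes f :: "'a::comm_monoid_add \<Rightarrow>\<^sub>0 'b::comm_monoid_add \<Rightarrow>\<^sub>0 'c::comm_semiring_0"
  shows "bcoeff (bmonom 0 c * f) x = c * bcoeff f x"
proof -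
  have "f \<in> monomial_span UNIV" by (simp add: monomial_span_def)
  then show ?thesis
    by (induction rule: monomial_span_induct)
      (simp_all add: distrib_left bmonom_mult bcoeff_bmonom)
qed


section \<open>Generators of an ideal spanned by monomials\<close>

text \<open>
  A semigroup \<open>E\<close> of exponents, a semigroup ideal \<open>P\<close> and the finite set \<open>M\<close> of elements of \<open>P\<close>
  that are minimal for divisibility by \<open>E\<close>.
\<close>

locale monomial_ideal =
  fixes E P M :: "('a::comm_monoid_add \<times> 'b::comm_monoid_add) set"
  assumes E_zero: "0 \<in> E" and E_add: "x \<in> E \<Longrightarrow> y \<in> E \<Longrightarrow> x + y \<in> E"
    and P_subset: "P \<subseteq> E" and P_add: "x \<in> E \<Longrightarrow> y \<in> P \<Longrightarrow> x + y \<in> P"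
    and M_subset: "M \<subseteq> P" and M_finite: "finite M"
    and M_minimal: "x \<in> E \<Longrightarrow> y \<in> P \<Longrightarrow> x + y \<in> M \<Longrightarrow> x = 0"
    and M_generates: "y \<in> P \<Longrightarrow> \<exists>x\<in>E. \<exists>z\<in>M. y = x + z"
begin

lemma ideal_monomial_span:
  "ideal (monomial_span P) (ring_on (monomial_span E :: ('a \<Rightarrow>\<^sub>0 'b \<Rightarrow>\<^sub>0 'k::field) set))"
proof (rule ideal_ring_on)
  show "cring (ring_on (monomial_span E :: ('a \<Rightarrow>\<^sub>0 'b \<Rightarrow>\<^sub>0 'k) set))"
    by (intro cring_monomial_span E_zero E_add)
  show "monomial_span P \<subseteq> (monomial_span E :: ('a \<Rightarrow>\<^sub>0 'b \<Rightarrow>\<^sub>0 'k) set)"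
    using P_subset by (auto simp: monomial_span_def)
qed (auto intro: monomial_span_zero monomial_span_add monomial_span_mult P_add)

lemma monomials_generate:
  "Idl\<^bsub>ring_on (monomial_span E)\<^esub> ((\<lambda>x. bmonom x 1) ` M) =
    (monomial_span P :: ('a \<Rightarrow>\<^sub>0 'b \<Rightarrow>\<^sub>0 'k::field) set)"
proof -
  let ?R = "ring_on (monomial_span E :: ('a \<Rightarrow>\<^sub>0 'b \<Rightarrow>\<^sub>0 'k) set)"
  let ?G = "(\<lambda>x. bmonom x 1) ` M :: ('a \<Rightarrow>\<^sub>0 'b \<Rightarrow>\<^sub>0 'k) set"
  interpret cring ?R by (intro cring_monomial_span E_zero E_add)
  have G: "?G \<subseteq> monomial_span P" using M_subset by (auto intro: monomial_span_bmonom)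
  then have GE: "?G \<subseteq> carrier ?R"
    using P_subset by (auto simp: monomial_span_def)
  interpret I: ideal "Idl\<^bsub>?R\<^esub> ?G" ?R by (rule genideal_ideal[OF GE])
  have "f \<in> Idl\<^bsub>?R\<^esub> ?G" if "f \<in> monomial_span P" for f
    using that
  proof (induction rule: monomial_span_induct)
    case zero
    then show ?case using I.zero_closed by simp
  next
    case (add y c g)
    then obtain x z where xz: "x \<in> E" "z \<in> M" "y = x + z" using M_generates by blast
    have "bmonom x c \<otimes>\<^bsub>?R\<^esub> bmonom z 1 \<in> Idl\<^bsub>?R\<^esub> ?G"
      using genideal_self[OF GE] xz by (intro I.I_l_closed) (auto intro: monomial_span_bmonom)
    then have "bmonom y c \<in> Idl\<^bsub>?R\<^esub> ?G" by (simp add: bmonom_mult xz)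
    then show ?case using I.a_closed add by fastforce
  qed
  moreover have "Idl\<^bsub>?R\<^esub> ?G \<subseteq> monomial_span P"
    by (rule genideal_minimal[OF ideal_monomial_span G])
  ultimately show ?thesis by blast
qed

text \<open>
  Projection to the coefficients at minimal exponents. On the ideal its kernel is spanned by the
  products of a nonconstant monomial of the algebra with a monomial of the ideal.
\<close>

definition truncate :: "('a \<Rightarrow>\<^sub>0 'b \<Rightarrow>\<^sub>0 'k::field) \<Rightarrow> ('a \<Rightarrow>\<^sub>0 'b \<Rightarrow>\<^sub>0 'k)" where
  "truncate f = (\<Sum>x\<in>M. bmonom x (bcoeff f x))"

lemma bcoeff_truncate: "bcoeff (truncate f) x = (if x \<in> M then bcoeff f x else 0)"
  by (simp add: truncate_def bcoeff_sum bcoeff_bmonom sum.delta'[OF M_finite])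

text \<open>
  A minimal exponent is a sum \<open>x + y\<close> with \<open>x \<in> E\<close> and \<open>y \<in> P\<close> only for \<open>x = 0\<close>. So a multiplier acts
  on the coefficients at minimal exponents through its constant term alone, that is, as a scalar.
\<close>

lemma truncate_mult:
  fixes f g :: "'a \<Rightarrow>\<^sub>0 'b \<Rightarrow>\<^sub>0 'k::field"
  assumes f: "f \<in> monomial_span E" and g: "g \<in> monomial_span P"
  shows "truncate (f * g) = bmonom 0 (bcoeff f 0) * truncate g"
proof -
  have mono: "bcoeff (bmonom x c * h) z = (if x = 0 then c else 0) * bcoeff h z"
    if "x \<in> E" "h \<in> monomial_span P" "z \<in> M" for x z :: "'a \<times> 'b" and c and h :: "'a \<Rightarrow>\<^sub>0 'b \<Rightarrow>\<^sub>0 'k"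
    using that(2)
  proof (induction rule: monomial_span_induct)
    case (add y d h)
    have "x = 0" if "z = x + y" using M_minimal[of x y] that add \<open>x \<in> E\<close> \<open>z \<in> M\<close> by simp
    then show ?case using add by (auto simp: distrib_left bmonom_mult bcoeff_bmonom)
  qed simp
  have "bcoeff (f * g) z = bcoeff f 0 * bcoeff g z" if "z \<in> M" for z
    using f
  proof (induction rule: monomial_span_induct)
    case (add x c h)
    then show ?case using mono[OF _ g that] by (simp add: distrib_right bcoeff_bmonom)
  qed simp
  then show ?thesis by (intro bcoeff_eqI) (simp add: bcoeff_scale bcoeff_truncate)
qed

text \<open>
  By \<open>truncate_mult\<close>, the elements whose truncation lies in the linear span of the truncated
  generators form an ideal. It contains the generators, hence everything, so \<open>card G\<close> vectors
  span the space of truncations, whose dimension is \<open>card M\<close>. This is the graded case of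
  Nakayama's lemma.
\<close>

lemma card_generators_ge:
  assumes fin: "finite G"
    and gen: "Idl\<^bsub>ring_on (monomial_span E)\<^esub> G = (monomial_span P :: ('a \<Rightarrow>\<^sub>0 'b \<Rightarrow>\<^sub>0 'k::field) set)"
    and G: "G \<subseteq> monomial_span E"
  shows "card M \<le> card G"
proof -
  let ?R = "ring_on (monomial_span E :: ('a \<Rightarrow>\<^sub>0 'b \<Rightarrow>\<^sub>0 'k) set)"
  interpret cring ?R by (intro cring_monomial_span E_zero E_add)
  interpret vs: vector_space "\<lambda>c f. bmonom 0 c * f :: 'a \<Rightarrow>\<^sub>0 'b \<Rightarrow>\<^sub>0 'k"
    by (rule vector_space_bmonom)
  have GP: "G \<subseteq> monomial_span P" using genideal_self[of G] G gen by simp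
  define J where "J = {f \<in> monomial_span P. truncate f \<in> vs.span (truncate ` G)}"
  have "ideal J ?R"
  proof (rule ideal_ring_on)
    show "cring ?R" by unfold_locales
    show "J \<subseteq> monomial_span E" using P_subset by (auto simp: J_def monomial_span_def)
    have "truncate 0 = (0 :: 'a \<Rightarrow>\<^sub>0 'b \<Rightarrow>\<^sub>0 'k)" by (simp add: truncate_def)
    then show "0 \<in> J" by (simp add: J_def monomial_span_zero vs.span_zero)
    fix f g :: "'a \<Rightarrow>\<^sub>0 'b \<Rightarrow>\<^sub>0 'k"
    assume g: "g \<in> J"
    have "truncate (f + g) = truncate f + truncate g"
      by (simp add: truncate_def bmonom_add sum.distrib)
    then show "f + g \<in> J" if "f \<in> J"
      using that g by (auto simp: J_def intro: monomial_span_add vs.span_add)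
    show "f * g \<in> J" if "f \<in> monomial_span E"
      using that g by (auto simp: J_def truncate_mult intro: monomial_span_mult P_add vs.span_scale)
  qed
  moreover have "G \<subseteq> J" using GP by (auto simp: J_def intro: vs.span_base)
  ultimately have PJ: "monomial_span P \<subseteq> J" using genideal_minimal gen by metis
  define N :: "('a \<Rightarrow>\<^sub>0 'b \<Rightarrow>\<^sub>0 'k) set" where "N = (\<lambda>x. bmonom x 1) ` M"
  have inj: "inj_on (\<lambda>x. bmonom x 1 :: 'a \<Rightarrow>\<^sub>0 'b \<Rightarrow>\<^sub>0 'k) M"
  proof (rule inj_onI)
    fix x y assume "bmonom x 1 = (bmonom y 1 :: 'a \<Rightarrow>\<^sub>0 'b \<Rightarrow>\<^sub>0 'k)"
    then have "bcoeff (bmonom x (1 :: 'k)) x = bcoeff (bmonom y 1) x" by simp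
    then show "x = y" by (simp add: bcoeff_bmonom split: if_splits)
  qed
  have "N \<subseteq> vs.span (truncate ` G)"
  proof
    fix f assume "f \<in> N"
    then obtain x where x: "x \<in> M" "f = bmonom x 1" by (auto simp: N_def)
    then have "f \<in> J" using PJ M_subset monomial_span_bmonom by blast
    moreover have "truncate f = f"
      using x by (intro bcoeff_eqI) (auto simp: bcoeff_truncate bcoeff_bmonom)
    ultimately show "f \<in> vs.span (truncate ` G)" by (simp add: J_def)
  qed
  moreover have "\<not> vs.dependent N"
  proof
    assume "vs.dependent N"
    then obtain u where u: "\<exists>v\<in>N. u v \<noteq> 0" "(\<Sum>v\<in>N. bmonom 0 (u v) * v) = 0"
      using vs.dependent_finite[of N] M_finite by (auto simp: N_def)
    have "u (bmonom x 1) = 0" if "x \<in> M" for x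
    proof -
      have "0 = bcoeff (\<Sum>v\<in>N. bmonom 0 (u v) * v) x" using u by simp
      also have "\<dots> = (\<Sum>y\<in>M. bcoeff (bmonom 0 (u (bmonom y 1)) * bmonom y 1) x)"
        by (simp add: bcoeff_sum N_def sum.reindex[OF inj])
      also have "\<dots> = u (bmonom x 1)"
        using that by (simp add: bmonom_mult bcoeff_bmonom sum.delta'[OF M_finite])
      finally show ?thesis by simp
    qed
    then show False using u by (auto simp: N_def)
  qed
  ultimately have "card N \<le> card (truncate ` G)"
    using vs.independent_span_bound[of "truncate ` G" N] fin by simp
  also have "\<dots> \<le> card G" using fin by (rule card_image_le)
  finally show ?thesis using card_image[OF inj] by (simp add: N_def)
qed

lemma min_num_generators_eq:
  "min_num_generators (ring_on (monomial_span E))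
    (monomial_span P :: ('a \<Rightarrow>\<^sub>0 'b \<Rightarrow>\<^sub>0 'k::field) set) = enat (card M)"
proof -
  let ?R = "ring_on (monomial_span E :: ('a \<Rightarrow>\<^sub>0 'b \<Rightarrow>\<^sub>0 'k) set)"
  let ?N = "(\<lambda>x. bmonom x 1) ` M :: ('a \<Rightarrow>\<^sub>0 'b \<Rightarrow>\<^sub>0 'k) set"
  let ?GG = "{G. finite G \<and> G \<subseteq> carrier ?R \<and> Idl\<^bsub>?R\<^esub> G = monomial_span P}"
  have "?N \<in> ?GG"
    using monomials_generate M_finite M_subset P_subset by (auto intro: monomial_span_bmonom)
  then have "(INF G\<in>?GG. enat (card G)) \<le> enat (card ?N)" by (rule INF_lower)
  also have "\<dots> \<le> enat (card M)" by (simp add: card_image_le M_finite)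
  finally have "(INF G\<in>?GG. enat (card G)) \<le> enat (card M)" .
  moreover have "enat (card M) \<le> (INF G\<in>?GG. enat (card G))"
    by (rule INF_greatest) (auto intro: card_generators_ge)
  ultimately show ?thesis unfolding min_num_generators_def by (rule antisym)
qed

end


section \<open>Exponents of the intersection algebra\<close>

text \<open>
  The exponents \<open>(r, s, m)\<close> of the monomials of the intersection algebra. The coordinates \<open>h\<^sub>i\<close> and
  \<open>k\<^sub>i\<close> of a solution are the slacks in the inequalities for \<open>m\<^sub>i\<close>, so nothing is lost in dropping
  them, and unlike vectors these triples live in a monoid type.
\<close>

definition exponents :: "nat \<Rightarrow> (nat \<Rightarrow> nat) \<Rightarrow> (nat \<Rightarrow> nat) \<Rightarrow> ((nat \<times> nat) \<times> (nat \<Rightarrow>\<^sub>0 nat)) set" where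
  "exponents n a b = {((r, s), m). Poly_Mapping.keys m \<subseteq> {1..n} \<and>
    (\<forall>i\<in>{1..n}. a i * r \<le> Poly_Mapping.lookup m i \<and> b i * s \<le> Poly_Mapping.lookup m i)}"

definition positive_exponents :: "nat \<Rightarrow> (nat \<Rightarrow> nat) \<Rightarrow> (nat \<Rightarrow> nat) \<Rightarrow> ((nat \<times> nat) \<times> (nat \<Rightarrow>\<^sub>0 nat)) set" where
  "positive_exponents n a b = {((r, s), m). 0 < r \<and> 0 < s \<and> Poly_Mapping.keys m \<subseteq> {1..n} \<and>
    (\<forall>i\<in>{1..n}. a i * r < Poly_Mapping.lookup m i \<and> b i * s < Poly_Mapping.lookup m i)}"

definition minimal_exponents :: "nat \<Rightarrow> (nat \<Rightarrow> nat) \<Rightarrow> (nat \<Rightarrow> nat) \<Rightarrow> ((nat \<times> nat) \<times> (nat \<Rightarrow>\<^sub>0 nat)) set" where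
  "minimal_exponents n a b = {p \<in> positive_exponents n a b.
    \<forall>e\<in>exponents n a b. \<forall>q\<in>positive_exponents n a b. p = e + q \<longrightarrow> e = 0}"

definition exponent :: "nat \<Rightarrow> (nat \<Rightarrow> nat) \<Rightarrow> (nat \<Rightarrow>\<^sub>0 nat)" where
  "exponent n e = (\<Sum>i\<in>{1..n}. Poly_Mapping.single i (e i))"

definition vec_exponent :: "nat \<Rightarrow> nat vec \<Rightarrow> (nat \<times> nat) \<times> (nat \<Rightarrow>\<^sub>0 nat)" where
  "vec_exponent n \<beta> = ((\<beta> $ 0, \<beta> $ 1), exponent n (\<lambda>i. \<beta> $ (3 * i + 1)))"

lemma lookup_exponent: "Poly_Mapping.lookup (exponent n e) i = (if i \<in> {1..n} then e i else 0)"
  by (simp add: exponent_def lookup_sum lookup_single when_def)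

lemma keys_exponent: "Poly_Mapping.keys (exponent n e) \<subseteq> {1..n}"
  by (auto simp: in_keys_iff lookup_exponent split: if_splits)

lemma exponent_eqI:
  assumes "Poly_Mapping.keys m \<subseteq> {1..n}" "Poly_Mapping.keys l \<subseteq> {1..n}"
    and "\<And>i. i \<in> {1..n} \<Longrightarrow> Poly_Mapping.lookup m i = Poly_Mapping.lookup l i"
  shows "m = l"
proof (rule poly_mapping_eqI)
  fix i show "Poly_Mapping.lookup m i = Poly_Mapping.lookup l i"
  proof (cases "i \<in> {1..n}")
    case False
    then have "i \<notin> Poly_Mapping.keys m" "i \<notin> Poly_Mapping.keys l" using assms by blast+
    then show ?thesis by (simp add: in_keys_iff)
  qed (rule assms(3))
qed

lemma keys_add_subset:
  fixes m l :: "nat \<Rightarrow>\<^sub>0 nat"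
  shows "Poly_Mapping.keys m \<subseteq> X \<Longrightarrow> Poly_Mapping.keys l \<subseteq> X \<Longrightarrow> Poly_Mapping.keys (m + l) \<subseteq> X"
  using keys_add[of m l] by blast

lemma exponents_zero: "0 \<in> exponents n a b"
  by (simp add: exponents_def zero_prod_def)

lemma exponents_add:
  assumes "x \<in> exponents n a b" "y \<in> exponents n a b"
  shows "x + y \<in> exponents n a b"
proof -
  obtain r s m where x: "x = ((r, s), m)" by (cases x) auto
  obtain r' s' l where y: "y = ((r', s'), l)" by (cases y) auto
  note xy = x y
  have "Poly_Mapping.keys (m + l) \<subseteq> {1..n}"
    using assms by (intro keys_add_subset) (simp_all add: xy exponents_def)
  then show ?thesis
    using assms by (auto simp: xy exponents_def distrib_left lookup_add intro!: add_mono)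
qed

lemma positive_exponents_subset: "positive_exponents n a b \<subseteq> exponents n a b"
  by (auto simp: exponents_def positive_exponents_def intro: less_imp_le)

lemma positive_exponents_add:
  assumes "x \<in> exponents n a b" "y \<in> positive_exponents n a b"
  shows "x + y \<in> positive_exponents n a b"
proof -
  obtain r s m where x: "x = ((r, s), m)" by (cases x) auto
  obtain r' s' l where y: "y = ((r', s'), l)" by (cases y) auto
  note xy = x y
  have "Poly_Mapping.keys (m + l) \<subseteq> {1..n}"
    using assms by (intro keys_add_subset) (simp_all add: xy exponents_def positive_exponents_def)
  then show ?thesis
    using assms
    by (auto simp: xy exponents_def positive_exponents_def distrib_left lookup_add
        intro!: add_le_less_mono)
qed

text \<open>
  Splitting off a nonzero element of \<open>exponents n a b\<close> lowers the coordinate sum, so the process of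
  splitting ends at a minimal exponent.
\<close>

lemma minimal_exponents_generate:
  assumes "p \<in> positive_exponents n a b"
  shows "\<exists>e\<in>exponents n a b. \<exists>q\<in>minimal_exponents n a b. p = e + q"
proof -
  define size where "size p = fst (fst p) + snd (fst p) + (\<Sum>i=1..n. Poly_Mapping.lookup (snd p) i)"
    for p :: "(nat \<times> nat) \<times> (nat \<Rightarrow>\<^sub>0 nat)"
  have size_add: "size (p + q) = size p + size q" for p q
    by (simp add: size_def lookup_add sum.distrib)
  have size_pos: "0 < size e" if "e \<in> exponents n a b" "e \<noteq> 0" for e
  proof (rule ccontr)
    assume "\<not> 0 < size e"
    then have "fst (fst e) = 0" "snd (fst e) = 0" "\<forall>i\<in>{1..n}. Poly_Mapping.lookup (snd e) i = 0"
      by (simp_all add: size_def)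
    moreover have "snd e = 0"
      using that calculation by (intro exponent_eqI[of _ n]) (auto simp: exponents_def)
    ultimately show False using \<open>e \<noteq> 0\<close> by (simp add: prod_eq_iff)
  qed
  show ?thesis
    using assms
  proof (induction "size p" arbitrary: p rule: less_induct)
    case less
    show ?case
    proof (cases "p \<in> minimal_exponents n a b")
      case True
      then show ?thesis using exponents_zero by (intro bexI[of _ 0] bexI[of _ p]) auto
    next
      case False
      then obtain e q where eq: "e \<in> exponents n a b" "q \<in> positive_exponents n a b" "p = e + q" "e \<noteq> 0"
        using less.prems by (auto simp: minimal_exponents_def)
      then have "size q < size p" using size_add size_pos by simp
      then obtain e' q' where "e' \<in> exponents n a b" "q' \<in> minimal_exponents n a b" "q = e' + q'"
        using less.hyps eq by blast
      then show ?thesis using eq exponents_add by (metis add.assoc)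
    qed
  qed
qed


section \<open>Solution vectors as exponents\<close>

lemma coordinate_cases:
  fixes j n :: nat
  assumes "j < 3 * n + 2"
  obtains "j = 0" | "j = 1" | i where "i \<in> {1..n}" "j = 3 * i - 1"
    | i where "i \<in> {1..n}" "j = 3 * i" | i where "i \<in> {1..n}" "j = 3 * i + 1"
proof -
  have j: "j = 3 * (j div 3) + j mod 3" by simp
  have "j mod 3 < 3" by simp
  then consider "j mod 3 = 0" | "j mod 3 = 1" | "j mod 3 = 2" by linarith
  then show thesis
  proof cases
    case 1
    show thesis
    proof (cases "j div 3 = 0")
      case True
      then show thesis using that(1) j 1 by linarith
    next
      case False
      then show thesis using that(4)[of "j div 3"] j 1 assms by (simp only: atLeastAtMost_iff) linarith
    qed
  next
    case 2
    show thesis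
    proof (cases "j div 3 = 0")
      case True
      then show thesis using that(2) j 2 by linarith
    next
      case False
      then show thesis using that(5)[of "j div 3"] j 2 assms by (simp only: atLeastAtMost_iff) linarith
    qed
  next
    case 3
    then obtain q where q: "j = 3 * q + 2" using j by metis
    then show thesis using that(3)[of "q + 1"] assms by simp
  qed
qed

lemma E_Phi_coordinates:
  assumes "\<beta> \<in> E_Phi n a b" "i \<in> {1..n}"
  shows "\<beta> $ (3 * i + 1) = a i * \<beta> $ 0 + \<beta> $ (3 * i - 1)"
    and "\<beta> $ (3 * i + 1) = b i * \<beta> $ 1 + \<beta> $ (3 * i)"
  using assms by (auto simp: E_Phi_iff)

lemma positive_iff_vec_exponent:
  assumes \<beta>: "\<beta> \<in> E_Phi n a b"
  shows "\<beta> \<in> positive_E n a b \<longleftrightarrow> vec_exponent n \<beta> \<in> positive_exponents n a b"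
proof -
  have dim: "dim_vec \<beta> = 3 * n + 2" using \<beta> by (auto simp: E_Phi_iff)
  note coords = E_Phi_coordinates[OF \<beta>]
  have "positive_vec \<beta> \<longleftrightarrow> 0 < \<beta> $ 0 \<and> 0 < \<beta> $ 1 \<and>
      (\<forall>i\<in>{1..n}. a i * \<beta> $ 0 < \<beta> $ (3 * i + 1) \<and> b i * \<beta> $ 1 < \<beta> $ (3 * i + 1))" (is "?L \<longleftrightarrow> ?R")
  proof
    assume L: ?L
    have "a i * \<beta> $ 0 < \<beta> $ (3 * i + 1) \<and> b i * \<beta> $ 1 < \<beta> $ (3 * i + 1)" if i: "i \<in> {1..n}" for i
    proof -
      have "0 < \<beta> $ (3 * i - 1)" "0 < \<beta> $ (3 * i)"
        using L i dim by (auto simp: positive_vec_def)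
      then show ?thesis using coords[OF i] by linarith
    qed
    then show ?R using L dim by (auto simp: positive_vec_def)
  next
    assume R: ?R
    show ?L
      unfolding positive_vec_def dim
    proof (intro allI impI)
      fix j assume "j < 3 * n + 2"
      then show "0 < \<beta> $ j"
      proof (cases rule: coordinate_cases)
        case (3 i) then show ?thesis using R coords(1)[of i] by fastforce
      next
        case (4 i) then show ?thesis using R coords(2)[of i] by fastforce
      next
        case (5 i)
        then have "a i * \<beta> $ 0 < \<beta> $ (3 * i + 1)" using R by blast
        then show ?thesis unfolding 5(2) by linarith
      qed (use R in auto)
    qed
  qed
  then show ?thesis
    using \<beta> keys_exponent[of n]
    by (simp add: positive_E_def vec_exponent_def positive_exponents_def lookup_exponent)
qed

text \<open>
  The coordinatewise order on solutions is divisibility: since the equations are linear, a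
  nonnegative difference of solutions is again a solution.
\<close>

lemma vec_le_iff_exponent:
  assumes \<beta>: "\<beta> \<in> E_Phi n a b" and \<gamma>: "\<gamma> \<in> E_Phi n a b"
  shows "(\<forall>j<3 * n + 2. \<gamma> $ j \<le> \<beta> $ j) \<longleftrightarrow>
    (\<exists>e\<in>exponents n a b. vec_exponent n \<beta> = e + vec_exponent n \<gamma>)"
proof
  assume le: "\<forall>j<3 * n + 2. \<gamma> $ j \<le> \<beta> $ j"
  define e where "e = ((\<beta> $ 0 - \<gamma> $ 0, \<beta> $ 1 - \<gamma> $ 1),
    exponent n (\<lambda>i. \<beta> $ (3 * i + 1) - \<gamma> $ (3 * i + 1)))"
  have le01: "\<gamma> $ 0 \<le> \<beta> $ 0" "\<gamma> $ 1 \<le> \<beta> $ 1" using le by auto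
  have lei: "\<gamma> $ (3 * i + 1) \<le> \<beta> $ (3 * i + 1)" "\<gamma> $ (3 * i) \<le> \<beta> $ (3 * i)"
    "\<gamma> $ (3 * i - 1) \<le> \<beta> $ (3 * i - 1)" if "i \<in> {1..n}" for i
    using le that by auto
  have "a i * (\<beta> $ 0 - \<gamma> $ 0) \<le> \<beta> $ (3 * i + 1) - \<gamma> $ (3 * i + 1) \<and>
      b i * (\<beta> $ 1 - \<gamma> $ 1) \<le> \<beta> $ (3 * i + 1) - \<gamma> $ (3 * i + 1)" if i: "i \<in> {1..n}" for i
  proof
    show "a i * (\<beta> $ 0 - \<gamma> $ 0) \<le> \<beta> $ (3 * i + 1) - \<gamma> $ (3 * i + 1)"
      using E_Phi_coordinates(1)[OF \<beta> i] E_Phi_coordinates(1)[OF \<gamma> i] lei(3)[OF i]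
      by (simp add: diff_mult_distrib2)
    show "b i * (\<beta> $ 1 - \<gamma> $ 1) \<le> \<beta> $ (3 * i + 1) - \<gamma> $ (3 * i + 1)"
      using E_Phi_coordinates(2)[OF \<beta> i] E_Phi_coordinates(2)[OF \<gamma> i] lei(2)[OF i]
      by (simp add: diff_mult_distrib2)
  qed
  then have "e \<in> exponents n a b"
    using keys_exponent[of n] by (simp add: e_def exponents_def lookup_exponent)
  moreover have "vec_exponent n \<beta> = e + vec_exponent n \<gamma>"
    using le01 lei by (auto simp: vec_exponent_def e_def lookup_exponent lookup_add intro!: poly_mapping_eqI)
  ultimately show "\<exists>e\<in>exponents n a b. vec_exponent n \<beta> = e + vec_exponent n \<gamma>" by blast
next
  assume "\<exists>e\<in>exponents n a b. vec_exponent n \<beta> = e + vec_exponent n \<gamma>"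
  then obtain r s m where e: "((r, s), m) \<in> exponents n a b"
    "vec_exponent n \<beta> = ((r, s), m) + vec_exponent n \<gamma>" by auto
  then have rs: "\<beta> $ 0 = r + \<gamma> $ 0" "\<beta> $ 1 = s + \<gamma> $ 1"
    and m: "exponent n (\<lambda>i. \<beta> $ (3 * i + 1)) = m + exponent n (\<lambda>i. \<gamma> $ (3 * i + 1))"
    by (auto simp: vec_exponent_def)
  have mi: "\<beta> $ (3 * i + 1) = Poly_Mapping.lookup m i + \<gamma> $ (3 * i + 1)" if "i \<in> {1..n}" for i
    using arg_cong[OF m, of "\<lambda>m. Poly_Mapping.lookup m i"] that by (simp add: lookup_add lookup_exponent)
  have ab: "a i * r \<le> Poly_Mapping.lookup m i" "b i * s \<le> Poly_Mapping.lookup m i"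
    if "i \<in> {1..n}" for i using e that by (auto simp: exponents_def)
  show "\<forall>j<3 * n + 2. \<gamma> $ j \<le> \<beta> $ j"
  proof (intro allI impI)
    fix j assume "j < 3 * n + 2"
    then show "\<gamma> $ j \<le> \<beta> $ j"
    proof (cases rule: coordinate_cases)
      case (3 i)
      then show ?thesis
        using E_Phi_coordinates(1)[OF \<beta>, of i] E_Phi_coordinates(1)[OF \<gamma>, of i] mi[of i] ab[of i] rs
        by (simp add: distrib_left)
    next
      case (4 i)
      then show ?thesis
        using E_Phi_coordinates(2)[OF \<beta>, of i] E_Phi_coordinates(2)[OF \<gamma>, of i] mi[of i] ab[of i] rs
        by (simp add: distrib_left)
    next
      case (5 i) then show ?thesis using mi[of i] by simp
    qed (use rs in auto)
  qed
qed

lemma inj_vec_exponent: "inj_on (vec_exponent n) (E_Phi n a b)"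
proof (rule inj_onI)
  fix \<beta> \<gamma> assume \<beta>: "\<beta> \<in> E_Phi n a b" and \<gamma>: "\<gamma> \<in> E_Phi n a b"
    and eq: "vec_exponent n \<beta> = vec_exponent n \<gamma>"
  have "\<gamma> $ j = \<beta> $ j" if "j < 3 * n + 2" for j
    using vec_le_iff_exponent[OF \<beta> \<gamma>] vec_le_iff_exponent[OF \<gamma> \<beta>] that eq exponents_zero
    by (metis add_0 order.antisym)
  then show "\<beta> = \<gamma>" using \<beta> \<gamma> by (intro eq_vecI) (auto simp: E_Phi_iff)
qed

lemma vec_exponent_surj:
  assumes "p \<in> exponents n a b" shows "p \<in> vec_exponent n ` E_Phi n a b"
proof -
  obtain r s m where p: "p = ((r, s), m)" by (cases p) auto
  define \<beta> where "\<beta> = vec (3 * n + 2) (\<lambda>j. if j = 0 then r else if j = 1 then s else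
    (let i = (j + 1) div 3; k = Poly_Mapping.lookup m i in
     if j mod 3 = 2 then k - a i * r else if j mod 3 = 0 then k - b i * s else k))"
  have coords: "\<beta> $ 0 = r" "\<beta> $ 1 = s" by (simp_all add: \<beta>_def)
  have coord: "\<beta> $ (3 * i + 1) = Poly_Mapping.lookup m i"
    "\<beta> $ (3 * i) = Poly_Mapping.lookup m i - b i * s"
    "\<beta> $ (3 * i - 1) = Poly_Mapping.lookup m i - a i * r" if i: "i \<in> {1..n}" for i
  proof -
    obtain k where k: "i = Suc k" using i by (cases i) auto
    have "(3 * i + 1 + 1) div 3 = i" "(3 * i + 1) mod 3 = 1" by simp_all
    then show "\<beta> $ (3 * i + 1) = Poly_Mapping.lookup m i"
      using i by (simp add: \<beta>_def Let_def)
    have "(3 * i + 1) div 3 = i" "3 * i mod 3 = 0" by simp_all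
    then show "\<beta> $ (3 * i) = Poly_Mapping.lookup m i - b i * s"
      using i by (simp add: \<beta>_def Let_def)
    have "3 * i - 1 = 3 * k + 2" using k by simp
    then show "\<beta> $ (3 * i - 1) = Poly_Mapping.lookup m i - a i * r"
      using i k by (simp add: \<beta>_def Let_def mod_Suc)
  qed
  have ge: "a i * r \<le> Poly_Mapping.lookup m i" "b i * s \<le> Poly_Mapping.lookup m i"
    if "i \<in> {1..n}" for i
    using assms that by (auto simp: p exponents_def)
  have "\<beta> \<in> carrier_vec (3 * n + 2)" by (simp add: \<beta>_def)
  moreover have "a i * \<beta> $ 0 + \<beta> $ (3 * i - 1) = \<beta> $ (3 * i + 1) \<and>
      b i * \<beta> $ 1 + \<beta> $ (3 * i) = \<beta> $ (3 * i + 1)" if "i \<in> {1..n}" for i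
    unfolding coord[OF that] coords using ge[OF that] by simp
  ultimately have "\<beta> \<in> E_Phi n a b" unfolding E_Phi_iff by blast
  moreover have "vec_exponent n \<beta> = p"
  proof -
    have "exponent n (\<lambda>i. \<beta> $ (3 * i + 1)) = m"
    proof (rule exponent_eqI[OF keys_exponent])
      show "Poly_Mapping.keys m \<subseteq> {1..n}" using assms by (simp add: p exponents_def)
      show "Poly_Mapping.lookup (exponent n (\<lambda>i. \<beta> $ (3 * i + 1))) i = Poly_Mapping.lookup m i"
        if "i \<in> {1..n}" for i using that coord(1)[OF that] by (simp add: lookup_exponent)
    qed
    then show ?thesis unfolding vec_exponent_def coords p by simp
  qed
  ultimately show ?thesis by blast
qed

lemma vec_exponent_positive_image:
  "vec_exponent n ` positive_E n a b = positive_exponents n a b"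
proof (intro equalityI subsetI)
  fix p assume p: "p \<in> positive_exponents n a b"
  then obtain \<beta> where "\<beta> \<in> E_Phi n a b" "p = vec_exponent n \<beta>"
    using vec_exponent_surj positive_exponents_subset by blast
  then show "p \<in> vec_exponent n ` positive_E n a b" using p positive_iff_vec_exponent by blast
qed (auto simp: positive_E_def positive_iff_vec_exponent[symmetric])

lemma vec_exponent_minimal_image:
  "vec_exponent n ` minimal_positive_E n a b = minimal_exponents n a b"
proof -
  have key: "\<beta> \<in> minimal_positive_E n a b \<longleftrightarrow> vec_exponent n \<beta> \<in> minimal_exponents n a b"
    if \<beta>: "\<beta> \<in> positive_E n a b" for \<beta>
  proof -
    have \<beta>E: "\<beta> \<in> E_Phi n a b" using \<beta> by (simp add: positive_E_def)
    have le: "(\<forall>j<3 * n + 2. \<gamma> $ j \<le> \<beta> $ j) \<longleftrightarrow>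
        (\<exists>e\<in>exponents n a b. vec_exponent n \<beta> = e + vec_exponent n \<gamma>)"
      if "\<gamma> \<in> positive_E n a b" for \<gamma>
      using that by (intro vec_le_iff_exponent \<beta>E) (simp add: positive_E_def)
    have "\<beta> \<in> minimal_positive_E n a b \<longleftrightarrow>
        \<not> (\<exists>\<gamma>\<in>positive_E n a b. \<gamma> \<noteq> \<beta> \<and> (\<forall>j<3 * n + 2. \<gamma> $ j \<le> \<beta> $ j))"
      unfolding minimal_positive_E_def using \<beta> by blast
    also have "\<dots> \<longleftrightarrow>
        (\<forall>\<gamma>\<in>positive_E n a b. \<forall>e\<in>exponents n a b. vec_exponent n \<beta> = e + vec_exponent n \<gamma> \<longrightarrow> \<gamma> = \<beta>)"
      using le by blast
    also have "\<dots> \<longleftrightarrow>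
        (\<forall>\<gamma>\<in>positive_E n a b. \<forall>e\<in>exponents n a b. vec_exponent n \<beta> = e + vec_exponent n \<gamma> \<longrightarrow> e = 0)"
    proof (intro ball_cong refl imp_cong)
      fix \<gamma> e assume \<gamma>: "\<gamma> \<in> positive_E n a b" and eq: "vec_exponent n \<beta> = e + vec_exponent n \<gamma>"
      have "\<gamma> = \<beta> \<longleftrightarrow> vec_exponent n \<gamma> = vec_exponent n \<beta>"
        using inj_vec_exponent[of n a b] \<gamma> \<beta>E by (auto simp: positive_E_def inj_on_eq_iff)
      then show "\<gamma> = \<beta> \<longleftrightarrow> e = 0" using eq by simp
    qed
    also have "\<dots> \<longleftrightarrow> vec_exponent n \<beta> \<in> minimal_exponents n a b"
      using \<beta> unfolding minimal_exponents_def vec_exponent_positive_image[symmetric] by blast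
    finally show ?thesis .
  qed
  have "minimal_positive_E n a b \<subseteq> positive_E n a b"
    "minimal_exponents n a b \<subseteq> vec_exponent n ` positive_E n a b"
    unfolding vec_exponent_positive_image by (auto simp: minimal_exponents_def minimal_positive_E_def)
  then show ?thesis using key by blast
qed


section \<open>Minimal exponents and the fan\<close>

lemma max_add_le_iff:
  fixes u v u' v' :: nat
  shows "max u v + max u' v' \<le> max (u + u') (v + v') \<longleftrightarrow> v \<le> u \<and> v' \<le> u' \<or> u \<le> v \<and> u' \<le> v'"
  by (auto simp: max_def)

text \<open>
  The interface between the data \<open>(a, b)\<close> and the two abstract settings: the fan of the rays and the
  monomial ideal with its minimal exponents.
\<close>

locale nondegenerate_pair =
  fixes n :: nat and a b :: "nat \<Rightarrow> nat"
  assumes n_ge_1: "1 \<le> n" and nondegenerate: "nondegenerate n a b"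
begin

lemma ext_b_pos:
  assumes "i \<le> n" shows "0 < ext_b n b (Suc i)"
proof (rule ccontr)
  assume "\<not> 0 < ext_b n b (Suc i)"
  then have "slope (ext_a n a (i + 1)) (ext_b n b (i + 1)) = \<infinity>" by (simp add: slope_def)
  moreover have "slope (ext_a n a (i + 1)) (ext_b n b (i + 1)) < slope (ext_a n a i) (ext_b n b i)"
    using nondegenerate assms by (simp add: nondegenerate_def)
  ultimately show False by simp
qed

lemma ext_a_pos:
  assumes "i \<le> n" shows "0 < ext_a n a i"
proof (cases i)
  case 0
  then show ?thesis by (simp add: ext_a_def)
next
  case (Suc j)
  have pos: "0 < ext_b n b i" "0 < ext_b n b (Suc i)" using ext_b_pos assms Suc by auto
  have "slope (ext_a n a (i + 1)) (ext_b n b (i + 1)) < slope (ext_a n a i) (ext_b n b i)"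
    using nondegenerate assms by (simp add: nondegenerate_def)
  then have "real (ext_a n a (Suc i)) / real (ext_b n b (Suc i)) < real (ext_a n a i) / real (ext_b n b i)"
    using pos by (simp add: slope_def)
  moreover have "0 \<le> real (ext_a n a (Suc i)) / real (ext_b n b (Suc i))" by simp
  ultimately have "0 < real (ext_a n a i) / real (ext_b n b i)" by linarith
  then show ?thesis by (simp add: zero_less_divide_iff)
qed

lemma ext_decreasing:
  assumes "i \<le> n"
  shows "ext_a n a (Suc i) * ext_b n b i < ext_a n a i * ext_b n b (Suc i)"
proof (cases "ext_b n b i = 0")
  case True
  then show ?thesis using ext_a_pos ext_b_pos assms by simp
next
  case False
  have pos: "0 < ext_b n b (Suc i)" using ext_b_pos assms by auto
  have "slope (ext_a n a (i + 1)) (ext_b n b (i + 1)) < slope (ext_a n a i) (ext_b n b i)"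
    using nondegenerate assms by (simp add: nondegenerate_def)
  then have "real (ext_a n a (Suc i)) / real (ext_b n b (Suc i)) < real (ext_a n a i) / real (ext_b n b i)"
    using pos False by (simp add: slope_def)
  then have "real (ext_a n a (Suc i) * ext_b n b i) < real (ext_a n a i * ext_b n b (Suc i))"
    using pos False by (simp add: divide_simps mult.commute)
  then show ?thesis by (simp only: of_nat_less_iff)
qed

sublocale fan: ray_fan n "\<lambda>i. int (ext_a n a i)" "\<lambda>i. int (ext_b n b i)"
proof
  show "0 < int (ext_b n b i)" if "1 \<le> i" "i \<le> Suc n" for i
    using that ext_b_pos[of "i - 1"] by simp
  show "int (ext_a n a (Suc i)) * int (ext_b n b i) < int (ext_a n a i) * int (ext_b n b (Suc i))"
    if "i \<le> n" for i
    using ext_decreasing[OF that] by (simp only: of_nat_mult[symmetric] of_nat_less_iff)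
qed (use n_ge_1 ext_a_pos in \<open>auto simp: ext_a_def ext_b_def\<close>)

text \<open>
  Solving for the coefficients of a point with respect to the two generators by Cramer's rule
  gives \<open>side\<close> values divided by the positive determinant \<open>D\<close>.
\<close>

lemma cone_semigroup_eq:
  assumes "i \<le> n" shows "cone_semigroup n a b i = fan.cone i"
proof -
  define A B A' B' where "A = real (ext_a n a i)" and "B = real (ext_b n b i)"
    and "A' = real (ext_a n a (Suc i))" and "B' = real (ext_b n b (Suc i))"
  define D where "D = A * B' - A' * B"
  have "real (ext_a n a (Suc i) * ext_b n b i) < real (ext_a n a i * ext_b n b (Suc i))"
    using ext_decreasing[OF assms] by (simp only: of_nat_less_iff)
  then have D: "0 < D" by (simp add: D_def A_def B_def A'_def B'_def)
  have cone_iff: "(x, y) \<in> fan_cone n a b i \<longleftrightarrow> 0 \<le> A * x - B * y \<and> A' * x - B' * y \<le> 0" for x y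
  proof
    assume "(x, y) \<in> fan_cone n a b i"
    then obtain l k where lk: "x = l * B + k * B'" "y = l * A + k * A'" "0 \<le> l" "0 \<le> k"
      by (auto simp: fan_cone_def A_def B_def A'_def B'_def)
    then have "A * x - B * y = k * D" "A' * x - B' * y = - (l * D)"
      by (simp_all add: D_def algebra_simps)
    then show "0 \<le> A * x - B * y \<and> A' * x - B' * y \<le> 0" using lk D by simp
  next
    assume xy: "0 \<le> A * x - B * y \<and> A' * x - B' * y \<le> 0"
    define l k where "l = (B' * y - A' * x) / D" and "k = (A * x - B * y) / D"
    have "0 \<le> l" "0 \<le> k" using xy D by (simp_all add: l_def k_def)
    have lk: "l * D = B' * y - A' * x" "k * D = A * x - B * y" using D by (simp_all add: l_def k_def)
    have "D * x = (l * D) * B + (k * D) * B'" "D * y = (l * D) * A + (k * D) * A'"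
      unfolding lk by (simp_all add: D_def algebra_simps)
    then have "D * x = D * (l * B + k * B')" "D * y = D * (l * A + k * A')"
      by (simp_all add: algebra_simps)
    then have "x = l * B + k * B'" "y = l * A + k * A'" using D by simp_all
    then show "(x, y) \<in> fan_cone n a b i"
      using \<open>0 \<le> l\<close> \<open>0 \<le> k\<close> by (auto simp: fan_cone_def A_def B_def A'_def B'_def)
  qed
  have "(real_of_int r, real_of_int s) \<in> fan_cone n a b i \<longleftrightarrow> (r, s) \<in> fan.cone i" for r s
  proof -
    have "A * real_of_int r - B * real_of_int s = real_of_int (fan.side i (r, s))"
      "A' * real_of_int r - B' * real_of_int s = real_of_int (fan.side (Suc i) (r, s))"
      by (simp_all add: fan.side_def A_def B_def A'_def B'_def)
    then show ?thesis unfolding cone_iff fan.cone_def by simp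
  qed
  then show ?thesis by (auto simp: cone_semigroup_def)
qed

text \<open>
  The function \<open>(r, s) \<mapsto> max (a i * r) (b i * s)\<close> is subadditive and linear on each side of ray \<open>i\<close>.
  Hence the reverse inequality holds exactly for two points on a common side.
\<close>

lemma cosigned_iff_max:
  "fan.cosigned (int r, int s) (int r', int s') \<longleftrightarrow>
    (\<forall>i\<in>{1..n}. max (a i * r) (b i * s) + max (a i * r') (b i * s') \<le> max (a i * (r + r')) (b i * (s + s')))"
proof -
  have side: "fan.side i (int x, int y) = int (a i * x) - int (b i * y)" if "i \<in> {1..n}" for i x y
  proof -
    have "ext_a n a i = a i" "ext_b n b i = b i" using that by (auto simp: ext_a_def ext_b_def)
    then show ?thesis by (simp add: fan.side_def)
  qed
  show ?thesis
    unfolding fan.cosigned_def distrib_left max_add_le_iff by (intro ball_cong refl) (simp add: side del: of_nat_mult)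
qed

text \<open>
  For positive \<open>r\<close> and \<open>s\<close>, the smallest \<open>x\<close>-exponent with which \<open>(r, s)\<close> extends to a positive solution.
\<close>

definition tight :: "nat \<Rightarrow> nat \<Rightarrow> (nat \<Rightarrow>\<^sub>0 nat)" where
  "tight r s = exponent n (\<lambda>i. max (a i * r) (b i * s) + 1)"

lemma lookup_tight:
  "i \<in> {1..n} \<Longrightarrow> Poly_Mapping.lookup (tight r s) i = max (a i * r) (b i * s) + 1"
  by (simp add: tight_def lookup_exponent)

lemma tight_positive: "0 < r \<Longrightarrow> 0 < s \<Longrightarrow> ((r, s), tight r s) \<in> positive_exponents n a b"
  using keys_exponent[of n] by (auto simp: positive_exponents_def lookup_tight tight_def lookup_exponent less_Suc_eq_le)

text \<open>
  If some \<open>m\<^sub>i\<close> exceeds the least admissible value, the variable \<open>x\<^sub>i\<close> can be split off.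
\<close>

lemma minimal_exponent_tight:
  assumes p: "((r, s), m) \<in> minimal_exponents n a b"
  shows "m = tight r s"
proof (rule exponent_eqI)
  have pos: "((r, s), m) \<in> positive_exponents n a b" using p by (simp add: minimal_exponents_def)
  show m: "Poly_Mapping.keys m \<subseteq> {1..n}" using pos by (simp add: positive_exponents_def)
  show "Poly_Mapping.keys (tight r s) \<subseteq> {1..n}" unfolding tight_def by (rule keys_exponent)
  fix i assume i: "i \<in> {1..n}"
  show "Poly_Mapping.lookup m i = Poly_Mapping.lookup (tight r s) i"
  proof (rule ccontr)
    assume "Poly_Mapping.lookup m i \<noteq> Poly_Mapping.lookup (tight r s) i"
    moreover have "a i * r < Poly_Mapping.lookup m i" "b i * s < Poly_Mapping.lookup m i"
      using pos i by (auto simp: positive_exponents_def)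
    ultimately have gt: "a i * r < Poly_Mapping.lookup m i - 1" "b i * s < Poly_Mapping.lookup m i - 1"
      using lookup_tight[OF i] by auto
    define e where "e = ((0 :: nat, 0 :: nat), Poly_Mapping.single i (1 :: nat))"
    define q where "q = ((r, s), m - Poly_Mapping.single i 1)"
    have "e \<in> exponents n a b" using i by (simp add: e_def exponents_def)
    moreover have "q \<in> positive_exponents n a b"
    proof -
      have "Poly_Mapping.keys (m - Poly_Mapping.single i 1) \<subseteq> Poly_Mapping.keys m"
        by (auto simp: in_keys_iff lookup_minus)
      then show ?thesis
        using pos m gt
        by (auto simp: q_def positive_exponents_def lookup_minus lookup_single when_def)
    qed
    moreover have "((r, s), m) = e + q"
    proof -
      have "m = Poly_Mapping.single i 1 + (m - Poly_Mapping.single i 1)"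
        using gt by (intro poly_mapping_eqI) (auto simp: lookup_add lookup_minus lookup_single when_def)
      then show ?thesis by (simp add: e_def q_def)
    qed
    ultimately have "e = 0" using p by (auto simp: minimal_exponents_def)
    then have "Poly_Mapping.single i (1 :: nat) = 0" by (simp add: e_def zero_prod_def)
    then show False by (metis lookup_single_eq lookup_zero one_neq_zero)
  qed
qed

text \<open>
  A splitting of \<open>(r, s, tight r s)\<close> into an exponent over \<open>y\<close> and a positive one over \<open>x\<close>
  requires the sum of the least admissible exponents over \<open>x\<close> and \<open>y\<close> to be at most \<open>tight r s\<close>.
  The summand \<open>1\<close> occurs once on both sides, so this is the inequality of \<open>cosigned_iff_max\<close>.
\<close>

lemma tight_minimal_iff:
  assumes rs: "0 < r" "0 < s"
  shows "((r, s), tight r s) \<in> minimal_exponents n a b \<longleftrightarrow> (int r, int s) \<in> fan.minimal_points"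
proof
  assume L: "((r, s), tight r s) \<in> minimal_exponents n a b"
  have "y = 0"
    if xy: "(int r, int s) = x + y" "y \<in> fan.quadrant" "0 < fst x" "0 < snd x" "fan.cosigned x y" for x y
  proof -
    define r1 s1 where "r1 = nat (fst x)" and "s1 = nat (snd x)"
    define r2 s2 where "r2 = nat (fst y)" and "s2 = nat (snd y)"
    have xe: "x = (int r1, int s1)" and ye: "y = (int r2, int s2)"
      using xy by (auto simp: r1_def s1_def r2_def s2_def)
    have sum: "r = r1 + r2" "s = s1 + s2" using xy(1) by (auto simp: xe ye)
    define e where "e = ((r2, s2), tight r s - tight r1 s1)"
    have le: "max (a i * r1) (b i * s1) + max (a i * r2) (b i * s2) \<le> max (a i * r) (b i * s)"
      if "i \<in> {1..n}" for i
      using xy(5) that unfolding xe ye cosigned_iff_max sum by blast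
    have "Poly_Mapping.lookup (tight r1 s1) i \<le> Poly_Mapping.lookup (tight r s) i" for i
      using le[of i] by (cases "i \<in> {1..n}") (auto simp: lookup_tight tight_def lookup_exponent)
    then have "((r, s), tight r s) = e + ((r1, s1), tight r1 s1)"
      by (auto simp: e_def sum lookup_add lookup_minus intro!: poly_mapping_eqI)
    moreover have "e \<in> exponents n a b"
    proof -
      have "Poly_Mapping.keys (tight r s - tight r1 s1) \<subseteq> Poly_Mapping.keys (tight r s)"
        by (auto simp: in_keys_iff lookup_minus)
      then have "Poly_Mapping.keys (tight r s - tight r1 s1) \<subseteq> {1..n}"
        using keys_exponent unfolding tight_def by blast
      moreover have "a i * r2 \<le> Poly_Mapping.lookup (tight r s - tight r1 s1) i \<and>
          b i * s2 \<le> Poly_Mapping.lookup (tight r s - tight r1 s1) i" if "i \<in> {1..n}" for i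
        using le[OF that] by (simp only: lookup_minus lookup_tight[OF that]) linarith
      ultimately show ?thesis by (simp add: e_def exponents_def)
    qed
    moreover have "((r1, s1), tight r1 s1) \<in> positive_exponents n a b"
      using xy by (intro tight_positive) (auto simp: r1_def s1_def)
    ultimately have "e = 0" using L unfolding minimal_exponents_def by blast
    then show "y = 0" by (simp add: e_def ye zero_prod_def)
  qed
  then show "(int r, int s) \<in> fan.minimal_points"
    using rs unfolding fan.minimal_points_def mem_Collect_eq
    by (intro conjI allI impI) (simp, simp, blast)
next
  assume R: "(int r, int s) \<in> fan.minimal_points"
  have "e = 0" if eq: "((r, s), tight r s) = e + q" and e: "e \<in> exponents n a b"
    and q: "q \<in> positive_exponents n a b" for e q
  proof -
    obtain r2 s2 m2 where e_eq: "e = ((r2, s2), m2)" by (cases e) auto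
    obtain r1 s1 m1 where q_eq: "q = ((r1, s1), m1)" by (cases q) auto
    have sum: "r = r1 + r2" "s = s1 + s2" and tight: "tight r s = m2 + m1"
      using eq by (auto simp: e_eq q_eq)
    have m: "max (a i * r) (b i * s) + 1 = Poly_Mapping.lookup m2 i + Poly_Mapping.lookup m1 i"
      "max (a i * r2) (b i * s2) \<le> Poly_Mapping.lookup m2 i"
      "max (a i * r1) (b i * s1) + 1 \<le> Poly_Mapping.lookup m1 i" if i: "i \<in> {1..n}" for i
    proof -
      show "max (a i * r) (b i * s) + 1 = Poly_Mapping.lookup m2 i + Poly_Mapping.lookup m1 i"
        using lookup_tight[OF i, of r s] by (simp add: tight lookup_add)
      show "max (a i * r2) (b i * s2) \<le> Poly_Mapping.lookup m2 i"
        using e i by (simp add: e_eq exponents_def)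
      show "max (a i * r1) (b i * s1) + 1 \<le> Poly_Mapping.lookup m1 i"
        using q i by (auto simp: q_eq positive_exponents_def Suc_le_eq)
    qed
    have "max (a i * r1) (b i * s1) + max (a i * r2) (b i * s2) \<le> max (a i * (r1 + r2)) (b i * (s1 + s2))"
      if "i \<in> {1..n}" for i
      using m[OF that] unfolding sum by linarith
    then have "fan.cosigned (int r1, int s1) (int r2, int s2)" unfolding cosigned_iff_max by blast
    moreover have "0 < r1" "0 < s1" using q by (auto simp: q_eq positive_exponents_def)
    moreover have "(int r, int s) = (int r1, int s1) + (int r2, int s2)" by (simp add: sum)
    moreover have "(int r2, int s2) \<in> fan.quadrant" by simp
    ultimately have "(int r2, int s2) = 0"
      using R unfolding fan.minimal_points_def mem_Collect_eq by (metis fst_conv of_nat_0_less_iff snd_conv)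
    then have zero: "r2 = 0" "s2 = 0" by (simp_all add: zero_prod_def)
    have "m2 = 0"
    proof (rule exponent_eqI[of _ n])
      show "Poly_Mapping.keys m2 \<subseteq> {1..n}" using e by (simp add: e_eq exponents_def)
      show "Poly_Mapping.lookup m2 i = Poly_Mapping.lookup 0 i" if "i \<in> {1..n}" for i
        using m[OF that] by (simp add: sum zero)
    qed simp
    then show "e = 0" by (simp add: e_eq zero zero_prod_def)
  qed
  then show "((r, s), tight r s) \<in> minimal_exponents n a b"
    using tight_positive[OF rs] unfolding minimal_exponents_def by blast
qed

lemma bij_betw_minimal_exponents:
  "bij_betw (\<lambda>p. (int (fst (fst p)), int (snd (fst p)))) (minimal_exponents n a b) fan.minimal_points"
    (is "bij_betw ?f _ _")
proof (rule bij_betwI')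
  fix p q assume pq: "p \<in> minimal_exponents n a b" "q \<in> minimal_exponents n a b"
  obtain r s m where p: "p = ((r, s), m)" by (cases p) auto
  obtain r' s' l where q: "q = ((r', s'), l)" by (cases q) auto
  show "?f p = ?f q \<longleftrightarrow> p = q"
    using minimal_exponent_tight[of r s m] minimal_exponent_tight[of r' s' l] pq by (auto simp: p q)
next
  fix p assume mem: "p \<in> minimal_exponents n a b"
  obtain r s m where p: "p = ((r, s), m)" by (cases p) auto
  have "0 < r" "0 < s" using mem by (auto simp: p minimal_exponents_def positive_exponents_def)
  then show "?f p \<in> fan.minimal_points"
    using mem minimal_exponent_tight[of r s m] tight_minimal_iff[of r s] by (simp add: p)
next
  fix y assume y: "y \<in> fan.minimal_points"
  define r s where "r = nat (fst y)" and "s = nat (snd y)"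
  have pos: "0 < fst y" "0 < snd y" using y by (auto simp: fan.minimal_points_def)
  then have "y = (int r, int s)" "0 < r" "0 < s" by (auto simp: r_def s_def prod_eq_iff)
  then show "\<exists>p\<in>minimal_exponents n a b. y = ?f p"
    using y tight_minimal_iff[of r s] by (intro bexI[of _ "((r, s), tight r s)"]) auto
qed

lemma finite_minimal_exponents: "finite (minimal_exponents n a b)"
  using bij_betw_finite[OF bij_betw_minimal_exponents] fan.finite_minimal_points by blast

lemma card_minimal_exponents:
  "int (card (minimal_exponents n a b)) =
    (\<Sum>i=0..n. int (card (hilbert_basis (cone_semigroup n a b i)))) - (int n + 2)"
proof -
  have "(\<Sum>i=0..n. int (card (hilbert_basis (cone_semigroup n a b i)))) =
      (\<Sum>i=0..n. int (card (hilbert_basis (fan.cone i))))"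
    by (intro sum.cong refl) (simp add: cone_semigroup_eq)
  then show ?thesis
    using fan.card_minimal_points bij_betw_same_card[OF bij_betw_minimal_exponents] by simp
qed

sublocale canonical: monomial_ideal "exponents n a b" "positive_exponents n a b" "minimal_exponents n a b"
proof
  show "minimal_exponents n a b \<subseteq> positive_exponents n a b" by (auto simp: minimal_exponents_def)
  show "x = 0"
    if "x \<in> exponents n a b" "y \<in> positive_exponents n a b" "x + y \<in> minimal_exponents n a b" for x y
    using that unfolding minimal_exponents_def by blast
qed (intro exponents_zero exponents_add positive_exponents_subset positive_exponents_add
    finite_minimal_exponents minimal_exponents_generate; assumption)+

end


section \<open>Monomials in the intersection algebra\<close>

lemma xmonom_eq: "xmonom n e = Poly_Mapping.single (exponent n e) (1 :: 'k::field)"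
proof -
  have power: "(xvar i :: (nat \<Rightarrow>\<^sub>0 nat) \<Rightarrow>\<^sub>0 'k) ^ k = Poly_Mapping.single (Poly_Mapping.single i k) 1" for i k
    by (induction k) (simp_all add: xvar_def mult_single single_add[symmetric])
  have "(\<Prod>i\<in>F. xvar i ^ e i :: (nat \<Rightarrow>\<^sub>0 nat) \<Rightarrow>\<^sub>0 'k) =
      Poly_Mapping.single (\<Sum>i\<in>F. Poly_Mapping.single i (e i)) 1" if "finite F" for F
    using that by (induction F rule: finite_induct) (simp_all add: power mult_single)
  then show ?thesis by (simp add: xmonom_def exponent_def)
qed

lemma exponent_scale: "(Poly_Mapping.single (exponent n e) (1 :: 'k::field)) ^ k =
    Poly_Mapping.single (exponent n (\<lambda>i. k * e i)) 1"
proof (induction k)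
  case 0
  have "exponent n (\<lambda>i. 0 * e i) = 0" by (simp add: exponent_def)
  then show ?case by simp
next
  case (Suc k)
  have "exponent n e + exponent n (\<lambda>i. k * e i) = exponent n (\<lambda>i. Suc k * e i)"
    by (intro poly_mapping_eqI) (simp add: lookup_add lookup_exponent)
  then show ?case using Suc by (simp add: mult_single)
qed

lemma cring_mpolys: "cring (ring_on (mpolys n :: ((nat \<Rightarrow>\<^sub>0 nat) \<Rightarrow>\<^sub>0 'k::field) set))"
proof (rule cring_ring_on)
  fix p q :: "(nat \<Rightarrow>\<^sub>0 nat) \<Rightarrow>\<^sub>0 'k" assume p: "p \<in> mpolys n"
  then show "- p \<in> mpolys n" by (simp add: mpolys_def in_keys_iff)
  assume q: "q \<in> mpolys n"
  show "p + q \<in> mpolys n" using p q keys_add[of p q] unfolding mpolys_def by blast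
  show "p * q \<in> mpolys n"
    unfolding mpolys_def
  proof (intro CollectI ballI)
    fix m assume "m \<in> Poly_Mapping.keys (p * q)"
    then obtain l l' where m: "m = l + l'" and "l \<in> Poly_Mapping.keys p" "l' \<in> Poly_Mapping.keys q"
      using keys_mult[of p q] by blast
    then show "Poly_Mapping.keys m \<subseteq> {1..n}"
      using p q unfolding m mpolys_def by (intro keys_add_subset) blast+
  qed
qed (simp_all add: mpolys_def)

lemma ideal_pow_principal:
  assumes R: "cring (ring_on S)" and x: "x \<in> S"
  shows "ideal_pow (ring_on S) (PIdl\<^bsub>ring_on S\<^esub> x) k = {f * x ^ k | f. f \<in> S}"
proof (induction k)
  case 0
  show ?case by simp
next
  case (Suc k)
  interpret cring "ring_on S" by (rule R)
  show ?case
  proof (intro equalityI subsetI)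
    fix g assume "g \<in> ideal_pow (ring_on S) (PIdl\<^bsub>ring_on S\<^esub> x) (Suc k)"
    then have "g \<in> ideal_prod (ring_on S) (PIdl\<^bsub>ring_on S\<^esub> x) {f * x ^ k | f. f \<in> S}"
      using Suc by simp
    then show "g \<in> {f * x ^ Suc k | f. f \<in> S}"
    proof induction
      case (prod i j)
      then obtain f h where f: "f \<in> S" "i = f * x" and h: "h \<in> S" "j = h * x ^ k"
        by (auto simp: cgenideal_def)
      then have "f * h \<in> S" using m_closed[of f h] by simp
      moreover have "i \<otimes>\<^bsub>ring_on S\<^esub> j = (f * h) * x ^ Suc k" using f h by (simp add: algebra_simps)
      ultimately show ?case by blast
    next
      case (sum s t)
      then obtain f h where f: "f \<in> S" "s = f * x ^ Suc k" and h: "h \<in> S" "t = h * x ^ Suc k" by blast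
      then have "f + h \<in> S" using a_closed[of f h] by simp
      moreover have "s \<oplus>\<^bsub>ring_on S\<^esub> t = (f + h) * x ^ Suc k" using f h by (simp add: distrib_right)
      ultimately show ?case by blast
    qed
  next
    fix g assume "g \<in> {f * x ^ Suc k | f. f \<in> S}"
    then obtain f where f: "f \<in> S" "g = f * x ^ Suc k" by blast
    have "1 \<in> S" using one_closed by simp
    then have "x \<in> PIdl\<^bsub>ring_on S\<^esub> x" by (auto simp: cgenideal_def intro!: exI[of _ 1])
    then have "x \<otimes>\<^bsub>ring_on S\<^esub> (f * x ^ k) \<in>
        ideal_prod (ring_on S) (PIdl\<^bsub>ring_on S\<^esub> x) {f * x ^ k | f. f \<in> S}"
      using f by (intro ideal_prod.prod) auto
    then show "g \<in> ideal_pow (ring_on S) (PIdl\<^bsub>ring_on S\<^esub> x) (Suc k)"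
      using f Suc by (simp add: algebra_simps)
  qed
qed

lemma monomial_multiples:
  assumes m: "Poly_Mapping.keys m \<subseteq> {1..n}"
  shows "{f * Poly_Mapping.single m (1 :: 'k::field) | f. f \<in> mpolys n} =
    {g \<in> mpolys n. \<forall>l\<in>Poly_Mapping.keys g. \<forall>i. Poly_Mapping.lookup m i \<le> Poly_Mapping.lookup l i}"
proof (intro equalityI subsetI)
  fix g assume "g \<in> {f * Poly_Mapping.single m (1 :: 'k) | f. f \<in> mpolys n}"
  then obtain f :: "(nat \<Rightarrow>\<^sub>0 nat) \<Rightarrow>\<^sub>0 'k"
    where f: "f \<in> mpolys n" "g = f * Poly_Mapping.single m 1" by blast
  have "\<exists>l'\<in>Poly_Mapping.keys f. l = l' + m" if "l \<in> Poly_Mapping.keys g" for l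
    using that keys_mult[of f "Poly_Mapping.single m 1"] f by auto
  note split = this
  have "Poly_Mapping.keys l \<subseteq> {1..n} \<and> (\<forall>i. Poly_Mapping.lookup m i \<le> Poly_Mapping.lookup l i)"
    if l: "l \<in> Poly_Mapping.keys g" for l
  proof -
    obtain l' where l': "l' \<in> Poly_Mapping.keys f" "l = l' + m" using split[OF l] by blast
    then have "Poly_Mapping.keys l' \<subseteq> {1..n}" using f unfolding mpolys_def by blast
    then have "Poly_Mapping.keys l \<subseteq> {1..n}" unfolding l'(2) using m by (rule keys_add_subset)
    then show ?thesis by (simp add: l'(2) lookup_add)
  qed
  then show "g \<in> {g \<in> mpolys n. \<forall>l\<in>Poly_Mapping.keys g. \<forall>i. Poly_Mapping.lookup m i \<le> Poly_Mapping.lookup l i}"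
    unfolding mpolys_def by blast
next
  fix g :: "(nat \<Rightarrow>\<^sub>0 nat) \<Rightarrow>\<^sub>0 'k"
  assume g: "g \<in> {g \<in> mpolys n. \<forall>l\<in>Poly_Mapping.keys g. \<forall>i. Poly_Mapping.lookup m i \<le> Poly_Mapping.lookup l i}"
  define f where "f = (\<Sum>l\<in>Poly_Mapping.keys g. Poly_Mapping.single (l - m) (Poly_Mapping.lookup g l))"
  have "f \<in> mpolys n"
    unfolding mpolys_def
  proof (intro CollectI ballI)
    fix k assume "k \<in> Poly_Mapping.keys f"
    then have "\<exists>l\<in>Poly_Mapping.keys g. k = l - m"
    proof (rule contrapos_pp)
      assume "\<not> (\<exists>l\<in>Poly_Mapping.keys g. k = l - m)"
      then have "Poly_Mapping.lookup f k = 0"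
        by (auto simp: f_def lookup_sum lookup_single when_def intro!: sum.neutral)
      then show "k \<notin> Poly_Mapping.keys f" by (simp add: in_keys_iff)
    qed
    then obtain l where l: "l \<in> Poly_Mapping.keys g" "k = l - m" by blast
    have "Poly_Mapping.keys (l - m) \<subseteq> Poly_Mapping.keys l" by (auto simp: in_keys_iff lookup_minus)
    then show "Poly_Mapping.keys k \<subseteq> {1..n}" using g l unfolding mpolys_def by blast
  qed
  moreover have "g = f * Poly_Mapping.single m 1"
  proof -
    have "l - m + m = l" if "l \<in> Poly_Mapping.keys g" for l
      using g that by (intro poly_mapping_eqI) (simp add: lookup_add lookup_minus)
    then have "f * Poly_Mapping.single m 1 =
        (\<Sum>l\<in>Poly_Mapping.keys g. Poly_Mapping.single l (Poly_Mapping.lookup g l))"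
      by (simp add: f_def sum_distrib_right mult_single)
    also have "\<dots> = g"
      by (rule poly_mapping_eqI)
        (auto simp: lookup_sum lookup_single when_def sum.delta in_keys_iff)
    finally show ?thesis by simp
  qed
  ultimately show "g \<in> {f * Poly_Mapping.single m (1 :: 'k) | f. f \<in> mpolys n}" by blast
qed

lemma ideal_pow_xmonom:
  "ideal_pow (ring_on (mpolys n)) (PIdl\<^bsub>ring_on (mpolys n)\<^esub> (xmonom n e)) k =
    {g :: (nat \<Rightarrow>\<^sub>0 nat) \<Rightarrow>\<^sub>0 'k::field.
      \<forall>m\<in>Poly_Mapping.keys g. Poly_Mapping.keys m \<subseteq> {1..n} \<and> (\<forall>i\<in>{1..n}. e i * k \<le> Poly_Mapping.lookup m i)}"
proof -
  have le: "(\<forall>i. Poly_Mapping.lookup (exponent n (\<lambda>i. k * e i)) i \<le> Poly_Mapping.lookup l i) \<longleftrightarrow>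
      (\<forall>i\<in>{1..n}. e i * k \<le> Poly_Mapping.lookup l i)" for l
    by (auto simp: lookup_exponent mult.commute)
  have xmonom_mem: "xmonom n e \<in> (mpolys n :: ((nat \<Rightarrow>\<^sub>0 nat) \<Rightarrow>\<^sub>0 'k) set)"
    using keys_exponent[of n e] by (simp add: xmonom_eq mpolys_def)
  show ?thesis
    unfolding ideal_pow_principal[OF cring_mpolys xmonom_mem]
    unfolding xmonom_eq exponent_scale monomial_multiples[OF keys_exponent]
    unfolding le mpolys_def by blast
qed

text \<open>
  The \<open>r\<close>-th power of the ideal of a monomial consists of the multiples of the \<open>r\<close>-th power of that
  monomial, and being such a multiple is a condition on each term separately.
\<close>

lemma monomial_intersection_algebra_eq:
  "monomial_intersection_algebra n a b =
    ring_on (monomial_span (exponents n a b) :: (nat \<times> nat \<Rightarrow>\<^sub>0 (nat \<Rightarrow>\<^sub>0 nat) \<Rightarrow>\<^sub>0 'k::field) set)"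
  unfolding monomial_intersection_algebra_def intersection_algebra_def ideal_pow_xmonom
  by (intro arg_cong[where f = ring_on] Set.set_eqI)
    (simp add: monomial_span_def bcoeff_def exponents_def lookup_not_eq_zero_eq_in_keys, blast)

lemma B_monom_eq: "B_monom n \<beta> = bmonom (vec_exponent n \<beta>) (1 :: 'k::field)"
  by (simp add: B_monom_def bmonom_def vec_exponent_def xmonom_eq)

lemma canonical_ideal_eq:
  "canonical_ideal n a b =
    (monomial_span (positive_exponents n a b) :: (nat \<times> nat \<Rightarrow>\<^sub>0 (nat \<Rightarrow>\<^sub>0 nat) \<Rightarrow>\<^sub>0 'k::field) set)"
proof -
  have scaled: "B_const c * B_monom n \<beta> = bmonom (vec_exponent n \<beta>) (c :: 'k)" for c \<beta>
  proof -
    have "B_const c = bmonom 0 c" by (simp add: B_const_def bmonom_def)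
    then show ?thesis by (simp add: B_monom_eq bmonom_mult)
  qed
  show ?thesis
  proof (intro equalityI subsetI)
    fix f :: "nat \<times> nat \<Rightarrow>\<^sub>0 (nat \<Rightarrow>\<^sub>0 nat) \<Rightarrow>\<^sub>0 'k"
    assume "f \<in> canonical_ideal n a b"
    then obtain F c where F: "finite F" "F \<subseteq> positive_E n a b"
      and f: "f = (\<Sum>\<beta>\<in>F. B_const (c \<beta>) * B_monom n \<beta>)" by (auto simp: canonical_ideal_def)
    have "(\<Sum>\<beta>\<in>F. bmonom (vec_exponent n \<beta>) (c \<beta>)) \<in> monomial_span (positive_exponents n a b)"
      using F vec_exponent_positive_image[of n a b]
      by (induction F rule: finite_induct)
        (auto intro!: monomial_span_zero monomial_span_add monomial_span_bmonom)
    then show "f \<in> monomial_span (positive_exponents n a b)" unfolding f scaled .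
  next
    fix f :: "nat \<times> nat \<Rightarrow>\<^sub>0 (nat \<Rightarrow>\<^sub>0 nat) \<Rightarrow>\<^sub>0 'k"
    assume f: "f \<in> monomial_span (positive_exponents n a b)"
    have inj: "inj_on (vec_exponent n) (positive_E n a b)"
      by (rule inj_on_subset[OF inj_vec_exponent]) (auto simp: positive_E_def)
    have "{x. bcoeff f x \<noteq> 0} \<subseteq> vec_exponent n ` positive_E n a b"
      using f by (auto simp: monomial_span_def vec_exponent_positive_image)
    then obtain F where F: "F \<subseteq> positive_E n a b" "{x. bcoeff f x \<noteq> 0} = vec_exponent n ` F"
      by (auto simp: subset_image_iff)
    have injF: "inj_on (vec_exponent n) F" using inj F(1) by (rule inj_on_subset)
    then have "finite F" using finite_bcoeff[of f] F(2) by (simp add: finite_image_iff)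
    moreover have "f = (\<Sum>\<beta>\<in>F. B_const (bcoeff f (vec_exponent n \<beta>)) * B_monom n \<beta>)"
      using bmonom_expansion[of f] unfolding F(2) sum.reindex[OF injF] scaled o_def .
    ultimately show "f \<in> canonical_ideal n a b"
      unfolding canonical_ideal_def using F(1) 
      by (intro CollectI exI[of _ F] exI[of _ "\<lambda>\<beta>. bcoeff f (vec_exponent n \<beta>)"]) blast
  qed
qed

theorem corollary2p19:
  fixes n :: nat and a b :: "nat \<Rightarrow> nat"
    and B :: "(nat \<times> nat \<Rightarrow>\<^sub>0 ((nat \<Rightarrow>\<^sub>0 nat) \<Rightarrow>\<^sub>0 'k::field)) ring"
  assumes "n \<ge> 1"
    and "nondegenerate n a b"
    and "B = monomial_intersection_algebra n a b"
  shows "finite (minimal_positive_E n a b)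
    \<and> int (card (minimal_positive_E n a b)) =
        (\<Sum>i=0..n. int (card (hilbert_basis (cone_semigroup n a b i)))) - (int n + 2)
    \<and> min_num_generators B (canonical_ideal n a b) = enat (card (minimal_positive_E n a b))"
proof -
  interpret nondegenerate_pair n a b using assms(1,2) by unfold_locales
  have inj: "inj_on (vec_exponent n) (minimal_positive_E n a b)"
    by (rule inj_on_subset[OF inj_vec_exponent]) (auto simp: minimal_positive_E_def positive_E_def)
  have fin: "finite (minimal_positive_E n a b)"
    using finite_minimal_exponents
    unfolding vec_exponent_minimal_image[symmetric] finite_image_iff[OF inj] .
  have card: "card (minimal_positive_E n a b) = card (minimal_exponents n a b)"
    unfolding vec_exponent_minimal_image[symmetric] card_image[OF inj] ..
  have "min_num_generators B (canonical_ideal n a b) = enat (card (minimal_exponents n a b))"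
    unfolding assms(3) monomial_intersection_algebra_eq canonical_ideal_eq
    by (rule canonical.min_num_generators_eq)
  then show ?thesis using fin card_minimal_exponents unfolding card by blast
qed

end
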